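(* Let $\|\cdot\|$ be a norm on $\mathbb{R}^d$ with dual norm $\|\cdot\|_\ast$, and let $\mathcal{X}$ be a closed convex set containing the ball $\{x:\|x\|\le R\}$ for some $R>0$. Let $T$ be a positive integer, $\Theta,\tilde M>0$ real numbers, $0<\eta<1/2$ a probability, and $\{z_i\}_{i\in\{1,\dots,T\}}$ independent random vectors in $\mathbb{R}^d$ such that, for a positive integer $K$: (i) $\|z_i\|_\ast\le1$ for every $i\in\{1,\dots,T\}$; (ii) $\mathbb{P}\big[\min_{x\in\mathcal{X}}\max_{i\in\{1,\dots,T\}}\langle z_i,x\rangle\le-\Theta\big]\ge1-\eta$; (iii) for every $i\in\{1,\dots,T\}$, $x\in\mathcal{X}$ and $\delta>0$, $\max\{\mathbb{P}[\langle z_i,x\rangle\ge\delta],\mathbb{P}[\langle z_i,x\rangle\le-\delta]\}\le\exp(-\tilde M\delta^2)$; (iv) $\Theta\ge64\,T\sqrt{\ln(TK/\eta)/\tilde M}$. Then, for every $L>0$, $\nu\in(0,1]$ (and integer $q\ge1$), there exists a family $\mathcal{F}$ of convex functions whose $q$-th derivatives are $(L,\nu)$-H\"older continuous with respect to $\|\cdot\|$, with a probability distribution $\Delta(\mathcal{F})$ on it, such that for any $K$-parallel (possibly randomized) algorithm $\mathcal{A}_K$ interacting with a local oracle $\mathcal{O}$, $$\mathbb{P}_{F\sim\Delta(\mathcal{F})}\left[\min_{t\in\{1,\dots,T\},\,k\in\{1,\dots,K\}}F(x_{t,k})-\min_{x\in\mathcal{X}}F(x)\ \ge\ \widetilde\Omega_q\!\left(LR^{q+\nu}\frac{\Theta^{q+\nu}}{T^{q+\nu-1}}\right)\right]\ge1-2\eta,$$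 where $\{x_{t,k}\}_{t\in\{1,\dots,T\},k\in\{1,\dots,K\}}$ is the sequence generated by the pair $(\mathcal{A}_K,\mathcal{O})$.
   Context: The $q$-th derivative of $F$ is $(L,\nu)$-H\"older continuous with respect to $\|\cdot\|$ if $\|\nabla^qF(x)-\nabla^qF(y)\|_\ast\le L\|x-y\|^\nu$ for all $x,y$, where for a $q$-linear form $G$, $\|G\|_\ast=\max_{\|v\|\le1}|G[v]^{\otimes q}|$. A local oracle is a map $(f,x)\mapsto\mathcal{O}_f(x)$ into a vector space such that $\mathcal{O}_f(x)=\mathcal{O}_g(x)$ whenever $f$ and $g$ in the function class coincide in a neighborhood of $x$. A $K$-parallel algorithm works in rounds: in round $t$ it issues a batch $X_t=(x_{t,1},\dots,x_{t,K})$, receives $(\mathcal{O}_F(x_{t,1}),\dots,\mathcal{O}_F(x_{t,K}))$, and $X_{t+1}$ is a (possibly randomized) function of all previous batches and answers. $\widetilde\Omega_q(\cdot)$ is big-$\Omega$ notation omitting factors depending on $q$ and logarithmic factors.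
   Formalization: The hidden constant may also depend on an upper bound for R (it depends on q only for R ≤ 1), since the printed bound with its R^{q+ν} factor fails for large R when T ≥ 2; the query points are taken in X and assumed to be measurable. *)

theory Defs
  imports "HOL-Probability.Probability" "HOL-Analysis.Finite_Function_Topology"
begin

text \<open>
  The hidden constants of the lower bound must not depend on the dimension \<open>d\<close>, so \<open>d\<close> has to
  be quantified inside the formula and cannot be a type. All spaces \<open>\<real>\<^sup>d\<close> are therefore taken
  inside the single normed space of finitely supported real sequences: \<open>\<real>\<^sup>d\<close> is the closed
  subspace of sequences supported in \<open>{..<d}\<close>. The ambient norm induces the usual topology,
  Borel sets and derivatives on it; it plays no other role.
\<close>

type_synonym vec = "nat \<Rightarrow>\<^sub>0 real"

definition Rd :: "nat \<Rightarrow> vec set" where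
  "Rd d = {x. Poly_Mapping.keys x \<subseteq> {..<d}}"

definition dotp :: "vec \<Rightarrow> vec \<Rightarrow> real" where
  "dotp z x = (\<Sum>i\<in>Poly_Mapping.keys z. Poly_Mapping.lookup z i * Poly_Mapping.lookup x i)"

definition norm_on :: "vec set \<Rightarrow> (vec \<Rightarrow> real) \<Rightarrow> bool" where
  "norm_on V N \<longleftrightarrow>
     (\<forall>x\<in>V. N x = 0 \<longleftrightarrow> x = 0) \<and>
     (\<forall>x\<in>V. \<forall>a. N (a *\<^sub>R x) = \<bar>a\<bar> * N x) \<and>
     (\<forall>x\<in>V. \<forall>y\<in>V. N (x + y) \<le> N x + N y)"

definition dual_norm :: "vec set \<Rightarrow> (vec \<Rightarrow> real) \<Rightarrow> vec \<Rightarrow> real" where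
  "dual_norm V N z = (SUP x\<in>{x\<in>V. N x \<le> 1}. dotp z x)"

text \<open>
  \<open>nabla V F [v\<^sub>1, \<dots>, v\<^sub>q] x\<close> is \<open>\<nabla>\<^sup>q F(x)[v\<^sub>1, \<dots>, v\<^sub>q]\<close>. Since \<open>V\<close> is a subspace, derivatives
  within \<open>V\<close> are uniquely determined on vectors of \<open>V\<close>. A map into the finite-dimensional space
  of multilinear forms is differentiable iff all its evaluations are.
\<close>

primrec nabla :: "vec set \<Rightarrow> (vec \<Rightarrow> real) \<Rightarrow> vec list \<Rightarrow> vec \<Rightarrow> real" where
  "nabla V F [] = F"
| "nabla V F (v # vs) = (\<lambda>x. frechet_derivative (nabla V F vs) (at x within V) v)"

definition times_differentiable_on :: "vec set \<Rightarrow> nat \<Rightarrow> (vec \<Rightarrow> real) \<Rightarrow> bool" where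
  "times_differentiable_on V q F \<longleftrightarrow>
     (\<forall>vs. set vs \<subseteq> V \<and> length vs < q \<longrightarrow> nabla V F vs differentiable_on V)"

definition form_norm :: "vec set \<Rightarrow> (vec \<Rightarrow> real) \<Rightarrow> nat \<Rightarrow> (vec list \<Rightarrow> real) \<Rightarrow> real" where
  "form_norm V N q G = (SUP v\<in>{v\<in>V. N v \<le> 1}. \<bar>G (replicate q v)\<bar>)"

definition holder_derivative ::
    "vec set \<Rightarrow> (vec \<Rightarrow> real) \<Rightarrow> nat \<Rightarrow> real \<Rightarrow> real \<Rightarrow> (vec \<Rightarrow> real) \<Rightarrow> bool" where
  "holder_derivative V N q L \<nu> F \<longleftrightarrow>
     times_differentiable_on V q F \<and>
     (\<forall>x\<in>V. \<forall>y\<in>V.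
        form_norm V N q (\<lambda>vs. nabla V F vs x - nabla V F vs y) \<le> L * N (x - y) powr \<nu>)"

text \<open>
  Functions on \<open>V\<close> are extensional, so that they are determined by their values on \<open>V\<close>. The
  \<open>\<sigma>\<close>-algebra of a distribution on a family is the one generated by the evaluations \<open>F \<mapsto> F x\<close>;
  the equation of \<open>\<sigma>\<close>-algebras also forces \<open>space \<Delta> = \<F>\<close>.
\<close>

definition distribution_on :: "vec set \<Rightarrow> (vec \<Rightarrow> real) set \<Rightarrow> (vec \<Rightarrow> real) measure \<Rightarrow> bool" where
  "distribution_on V \<F> \<Delta> \<longleftrightarrow>
     \<F> \<subseteq> extensional V \<and> prob_space \<Delta> \<and>
     sets \<Delta> = sets (restrict_space (\<Pi>\<^sub>M x\<in>V. borel) \<F>)"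

definition local_oracle ::
    "vec set \<Rightarrow> (vec \<Rightarrow> real) set \<Rightarrow> ((vec \<Rightarrow> real) \<Rightarrow> vec \<Rightarrow> 'v::real_vector) \<Rightarrow> bool" where
  "local_oracle V \<F> orc \<longleftrightarrow>
     (\<forall>f\<in>\<F>. \<forall>g\<in>\<F>. \<forall>x\<in>V.
        (\<exists>U. open U \<and> x \<in> U \<and> (\<forall>y\<in>U \<inter> V. f y = g y)) \<longrightarrow> orc f x = orc g x)"

text \<open>
  A history is the list of the previous batches, each with its list of answers. Given its seed,
  an algorithm maps the history to the next batch; all its randomness is in the seed, which is
  drawn independently of the function.
\<close>

type_synonym 'v history = "(vec list \<times> 'v list) list"

definition parallel_algorithm ::
    "nat \<Rightarrow> vec set \<Rightarrow> 's measure \<Rightarrow> ('s \<Rightarrow> 'v history \<Rightarrow> vec list) \<Rightarrow> bool" where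
  "parallel_algorithm K X S alg \<longleftrightarrow>
     prob_space S \<and> (\<forall>s\<in>space S. \<forall>h. length (alg s h) = K \<and> set (alg s h) \<subseteq> X)"

primrec transcript :: "('v history \<Rightarrow> vec list) \<Rightarrow> (vec \<Rightarrow> 'v) \<Rightarrow> nat \<Rightarrow> 'v history" where
  "transcript a ans 0 = []"
| "transcript a ans (Suc t) =
     (let h = transcript a ans t; Q = a h in h @ [(Q, map ans Q)])"

definition query :: "('v history \<Rightarrow> vec list) \<Rightarrow> (vec \<Rightarrow> 'v) \<Rightarrow> nat \<Rightarrow> nat \<Rightarrow> vec" where
  "query a ans t k = a (transcript a ans (t - 1)) ! (k - 1)"

text \<open>
  The iterates are random vectors. Oracle and algorithm are otherwise arbitrary set-theoretic
  maps, so this is what gives probabilities of events about the iterates a meaning.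
\<close>

definition random_queries ::
    "nat \<Rightarrow> nat \<Rightarrow> 's measure \<Rightarrow> ('s \<Rightarrow> 'v history \<Rightarrow> vec list) \<Rightarrow>
     (vec \<Rightarrow> real) measure \<Rightarrow> ((vec \<Rightarrow> real) \<Rightarrow> vec \<Rightarrow> 'v) \<Rightarrow> bool" where
  "random_queries T K S alg \<Delta> orc \<longleftrightarrow>
     (\<forall>t\<in>{1..T}. \<forall>k\<in>{1..K}.
        (\<lambda>(s, F). query (alg s) (orc F) t k) \<in> borel_measurable (S \<Otimes>\<^sub>M \<Delta>))"

text \<open>Optimality gap of the best query; the infimum is taken in the extended reals.\<close>

definition gap ::
    "nat \<Rightarrow> nat \<Rightarrow> vec set \<Rightarrow> (nat \<Rightarrow> nat \<Rightarrow> vec) \<Rightarrow> (vec \<Rightarrow> real) \<Rightarrow> ereal" where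
  "gap T K X x F =
     ereal (Min {F (x t k) | t k. t \<in> {1..T} \<and> k \<in> {1..K}}) - (INF y\<in>X. ereal (F y))"

end

theory Submission
  imports Defs
begin

text \<open>
  The hard functions are soft maxima of the shifted linear functions
  \<open>\<langle>z\<^sub>i, x\<rangle> / \<mu> - G * i\<close>. A query that is independent of \<open>z\<^sub>t, z\<^sub>t\<^sub>+\<^sub>1, \<dots>\<close> has small inner products
  with these vectors by concentration, so the shifts make the functions \<open>i > t\<close> invisible
  near it: a local oracle reveals at most one new \<open>z\<^sub>t\<close> per round, and every query keeps a value far
  above the minimum.

  The soft maximum has to be exactly local, smooth to order \<open>q + 1\<close>, and its derivatives may grow
  only polylogarithmically with the number of arguments. It is a balanced binary tree of the binary
  soft maxima \<open>b + \<phi> (a - b)\<close>, where \<open>\<phi>\<close> is a smooth version of \<open>max 0\<close> that agrees with it off a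
  bounded interval. At each node the derivative of highest order enters through a convex combination
  of those of the children, so it grows by lower order terms only, and its size is polynomial in
  the depth of the tree.

  Algorithm and oracle are not assumed to be measurable, only the queries on functions of the family
  are. The family is therefore closed under replacing all later vectors by \<open>z\<^sub>t\<close>, and the round \<open>t + 1\<close>
  queries are compared with those made on the function that knows only \<open>z\<^sub>1, \<dots>, z\<^sub>t\<close>; the latter
  are measurable and independent of the remaining vectors.
\<close>


section \<open>A smooth ramp\<close>

text \<open>The constants balance four requirements. Exact locality of the tree costs
  \<open>2 * w * l\<close>, where the half-width \<open>w\<close> of the transition zone is
  \<open>q + 1\<close> and the depth \<open>l\<close> is logarithmic in \<open>T\<close>; the shift
  \<open>G\<close> has to exceed this cost. The common descent \<Theta> has to dominate all
  \<open>T\<close> shifts after the argument is scaled by \<open>1 / \<mu>\<close>, hence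
  \<open>\<mu> = \<Theta> / (4 * T * G)\<close>. One inner product may then deviate by
  \<open>G * \<mu> / 4 = \<Theta> / (16 * T)\<close>, which is large enough for a union bound over
  the \<open>T * K\<close> queries and \<open>T\<close> vectors. Scaling multiplies the Hoelder
  constant by \<open>\<mu> powr - (q + \<nu>)\<close>, so a bound \<open>B\<close> on the unscaled
  derivatives fixes the amplitude by \<open>A * (2 * B) = L * \<mu> powr (q + \<nu>)\<close>. The
  resulting gap \<open>A * G * T\<close> is the claimed rate up to powers of \<open>G\<close> and
  \<open>B\<close>, so both must be polylogarithmic in \<open>T\<close>. Log-sum-exp would be smooth
  enough, but its value depends on every argument everywhere, so every answer would reveal all
  vectors. Order \<open>q + 1\<close> enters because the exponent \<nu> is obtained by interpolating
  between a bounded and a Lipschitz \<open>q\<close>-th derivative.\<close>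

text \<open>
  The ramp is obtained from \<open>max 0\<close> by averaging over intervals of length 2; each averaging step
  gains one derivative, widens the transition zone by 1 and keeps all other properties.
\<close>

definition ramp_jet :: "nat \<Rightarrow> (nat \<Rightarrow> real \<Rightarrow> real) \<Rightarrow> bool" where
  "ramp_jet k D \<longleftrightarrow>
     (\<forall>j<k. \<forall>s. (D j has_real_derivative D (Suc j) s) (at s)) \<and>
     (\<forall>j\<in>{1..k}. \<exists>C. \<forall>s. \<bar>D j s\<bar> \<le> C) \<and>
     (\<forall>s t. s \<le> t \<longrightarrow> 0 \<le> D 0 t - D 0 s \<and> D 0 t - D 0 s \<le> t - s) \<and>
     (\<forall>s t h. s \<le> t \<longrightarrow> 0 \<le> h \<longrightarrow> D 0 (s + h) - D 0 s \<le> D 0 (t + h) - D 0 t) \<and>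
     (\<forall>s\<le>- real k. D 0 s = 0) \<and> (\<forall>s\<ge>real k. D 0 s = s) \<and>
     (0 < k \<longrightarrow> convex_on UNIV (D 0) \<and> (\<forall>s. 0 \<le> D 1 s \<and> D 1 s \<le> 1))"

lemma ramp_jet_exists: "\<exists>D. ramp_jet k D"
proof (induction k)
  case 0
  have "ramp_jet 0 (\<lambda>_ s. max 0 s)"
    by (auto simp: ramp_jet_def)
  then show ?case by blast
next
  case (Suc k)
  then obtain D where D: "ramp_jet k D" by blast
  have der: "(D j has_real_derivative D (Suc j) s) (at s)" if "j < k" for j s
    using D that by (auto simp: ramp_jet_def)
  have bdd: "\<exists>C. \<forall>s. \<bar>D j s\<bar> \<le> C" if "1 \<le> j" "j \<le> k" for j
    using D that by (auto simp: ramp_jet_def)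
  have lip: "0 \<le> D 0 t - D 0 s \<and> D 0 t - D 0 s \<le> t - s" if "s \<le> t" for s t
    using D that by (auto simp: ramp_jet_def)
  have inc: "D 0 (s + h) - D 0 s \<le> D 0 (t + h) - D 0 t" if "s \<le> t" "0 \<le> h" for s t h
    using D that by (auto simp: ramp_jet_def)
  have lo: "D 0 s = 0" if "s \<le> - real k" for s
    using D that by (auto simp: ramp_jet_def)
  have hi: "D 0 s = s" if "s \<ge> real k" for s
    using D that by (auto simp: ramp_jet_def)
  \<comment> \<open>Continuity comes from the Lipschitz clause because for \<open>k = 0\<close> the
    jet provides no derivative.\<close>
  have "1-lipschitz_on UNIV (D 0)"
    by (rule lipschitz_onI) (smt (verit) dist_real_def lip, simp)
  then have "continuous_on UNIV (D 0)"
    by (rule lipschitz_on_continuous_on)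
  then have "isCont (D 0) s" for s
    by (simp add: continuous_on_eq_continuous_at)
  then obtain P where P: "(P has_real_derivative D 0 s) (at s)" for s
    using einterval_antiderivative[of "-\<infinity>" "\<infinity>" "D 0"]
    by (auto simp: has_real_derivative_iff_has_vector_derivative)
  have P1: "((\<lambda>s. P (s + c)) has_real_derivative D 0 (s + c)) (at s)" for c s
    using DERIV_shift[of P "D 0 (s + c)" s c] P by simp
  \<comment> \<open>\<open>E 0\<close> is the mean of \<open>D 0\<close> over
    \<open>[s - 1, s + 1]\<close>, written with an antiderivative. Its first derivative is a
    difference of values of \<open>D 0\<close>, so one order is gained.\<close>
  define E where "E j s = (case j of 0 \<Rightarrow> (P (s + 1) - P (s + -1)) / 2
      | Suc i \<Rightarrow> (D i (s + 1) - D i (s + -1)) / 2)" for j s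
  have E0: "(E 0 has_real_derivative E 1 s) (at s)" for s
    unfolding E_def by (auto intro!: derivative_eq_intros P1 P1[of "- 1", simplified])
  have E1: "0 \<le> E 1 s \<and> E 1 s \<le> 1" for s
    using lip[of "s + -1" "s + 1"] by (auto simp: E_def algebra_simps)
  \<comment> \<open>Half an increment of \<open>D 0\<close> over a step of length 2: the clause on
    increments is convexity in a form that makes sense before any derivative exists.\<close>
  have E1_mono: "E 1 s \<le> E 1 t" if "s \<le> t" for s t
    using inc[of "s - 1" "t - 1" 2] that by (simp add: E_def divide_right_mono add.commute)
  have derE: "(E j has_real_derivative E (Suc j) s) (at s)" if "j < Suc k" for j s
  proof (cases j)
    case 0
    then show ?thesis using E0 by simp
  next
    case (Suc i)
    then have "i < k" using that by simp
    then have shift: "((\<lambda>s. D i (s + c)) has_real_derivative D (Suc i) (s + c)) (at s)" for c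
      using DERIV_shift[of "D i" "D (Suc i) (s + c)" s c] der by blast
    show ?thesis
      unfolding E_def Suc nat.case
      by (rule DERIV_cdivide[OF DERIV_diff[OF shift[of 1] shift[of "- 1"]]])
  qed
  have bddE: "\<exists>C. \<forall>s. \<bar>E j s\<bar> \<le> C" if j: "1 \<le> j" "j \<le> Suc k" for j
  proof (cases "j = 1")
    case True
    then show ?thesis using E1 by (intro exI[of _ 1]) (simp add: abs_of_nonneg)
  next
    case False
    then obtain i where i: "j = Suc i" "1 \<le> i" "i \<le> k"
      using j by (cases j) auto
    then obtain C where C: "\<And>s. \<bar>D i s\<bar> \<le> C" using bdd by blast
    have "\<bar>E j s\<bar> \<le> C" for s
      using C[of "s + 1"] C[of "s + -1"] by (simp add: E_def i)
    then show ?thesis by blast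
  qed
  have lipE: "0 \<le> E 0 t - E 0 s \<and> E 0 t - E 0 s \<le> t - s" if "s \<le> t" for s t
  proof
    have "E 0 s \<le> E 0 t"
      using E0 E1 by (intro DERIV_nonneg_imp_nondecreasing[OF that]) blast
    then show "0 \<le> E 0 t - E 0 s" by simp
    have "s - E 0 s \<le> t - E 0 t"
    proof (rule DERIV_nonneg_imp_nondecreasing[OF that])
      fix x
      have "((\<lambda>s. s - E 0 s) has_real_derivative 1 - E 1 x) (at x)"
        by (auto intro!: derivative_eq_intros E0)
      then show "\<exists>y. ((\<lambda>s. s - E 0 s) has_real_derivative y) (at x) \<and> 0 \<le> y"
        using E1[of x] by force
    qed
    then show "E 0 t - E 0 s \<le> t - s" by simp
  qed
  have incE: "E 0 (s + h) - E 0 s \<le> E 0 (t + h) - E 0 t" if "s \<le> t" "0 \<le> h" for s t h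
  proof (rule DERIV_nonneg_imp_nondecreasing[OF that(1)])
    fix x
    have "((\<lambda>s. E 0 (s + h)) has_real_derivative E 1 (x + h)) (at x)"
      using DERIV_shift[of "E 0" "E 1 (x + h)" x h] E0 by simp
    then have "((\<lambda>s. E 0 (s + h) - E 0 s) has_real_derivative E 1 (x + h) - E 1 x) (at x)"
      by (auto intro!: derivative_eq_intros E0)
    then show "\<exists>y. ((\<lambda>s. E 0 (s + h) - E 0 s) has_real_derivative y) (at x) \<and> 0 \<le> y"
      using E1_mono[of x "x + h"] that by force
  qed
  have loE: "E 0 s = 0" if "s \<le> - real (Suc k)" for s
  proof -
    obtain u where "u < s + 1" "P (s + 1) - P (s + -1) = (s + 1 - (s + -1)) * D 0 u"
      using MVT2[of "s + -1" "s + 1" P "D 0"] P by auto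
    then show ?thesis using lo[of u] that by (simp add: E_def)
  qed
  have hiE: "E 0 s = s" if "s \<ge> real (Suc k)" for s
  proof -
    \<comment> \<open>Subtracting the antiderivative of the identity gives a function with
      derivative \<open>D 0 u - u\<close>, which vanishes beyond \<open>k\<close>; the mean over the
      interval is then exactly its midpoint \<open>s\<close>.\<close>
    have "((\<lambda>u. P u - u\<^sup>2 / 2) has_real_derivative D 0 u - u) (at u)" for u
      by (auto intro!: derivative_eq_intros P)
    then obtain u where "s + -1 < u"
      "P (s + 1) - (s + 1)\<^sup>2 / 2 - (P (s + -1) - (s + -1)\<^sup>2 / 2) = (s + 1 - (s + -1)) * (D 0 u - u)"
      using MVT2[of "s + -1" "s + 1" "\<lambda>u. P u - u\<^sup>2 / 2" "\<lambda>u. D 0 u - u"] by auto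
    then show ?thesis using hi[of u] that by (simp add: E_def power2_eq_square field_simps)
  qed
  have "convex_on UNIV (E 0)"
    by (rule convex_on_realI[of UNIV _ "E 1"]) (rule connected_UNIV E0 E1_mono, assumption?)+
  then have "ramp_jet (Suc k) E"
    unfolding ramp_jet_def
    by (intro conjI allI impI ballI)
      (use derE bddE lipE incE loE hiE E1 in \<open>simp_all\<close>)
  then show ?case by blast
qed

section \<open>Soft maxima\<close>

locale ramp =
  fixes \<phi> :: "real \<Rightarrow> real" and w :: real
  assumes w_nonneg: "0 \<le> w"
    and mono_ramp: "s \<le> t \<Longrightarrow> \<phi> s \<le> \<phi> t"
    and lip_ramp: "s \<le> t \<Longrightarrow> \<phi> t - \<phi> s \<le> t - s"
    and ramp_low: "s \<le> - w \<Longrightarrow> \<phi> s = 0"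
    and ramp_high: "w \<le> s \<Longrightarrow> \<phi> s = s"
    and convex_ramp: "convex_on UNIV \<phi>"
begin

lemma ramp_nonneg: "0 \<le> \<phi> s"
  using mono_ramp[of "min s (- w)" s] ramp_low[of "min s (- w)"] by simp

lemma ramp_ge: "s \<le> \<phi> s"
  using lip_ramp[of s "max s w"] ramp_high[of "max s w"] by simp

lemma ramp_le: "\<phi> s \<le> max 0 s + w"
  using mono_ramp[of s w] ramp_high[of s] ramp_high[of w] w_nonneg by (cases "s \<le> w") auto

text \<open>The node of height \<open>l\<close> at \<open>i\<close> covers the leaves
  \<open>i, ..., i + 2 ^ l - 1\<close> of an infinite sequence, so no padding of finite lists is
  needed.\<close>

primrec smax :: "nat \<Rightarrow> (nat \<Rightarrow> real) \<Rightarrow> nat \<Rightarrow> real" where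
  "smax 0 y i = y i"
| "smax (Suc l) y i = smax l y (i + 2 ^ l) + \<phi> (smax l y i - smax l y (i + 2 ^ l))"

text \<open>A node \<open>b + \<phi> (a - b)\<close> is at least \<open>b\<close> because \<phi> is
  nonnegative, and at least \<open>a\<close> because \<phi> lies above the identity.\<close>

lemma smax_ge: "j < 2 ^ l \<Longrightarrow> y (i + j) \<le> smax l y i"
proof (induction l arbitrary: i j)
  case (Suc l)
  show ?case
  proof (cases "j < 2 ^ l")
    case True
    then show ?thesis
      using Suc.IH[of j i] ramp_ge[of "smax l y i - smax l y (i + 2 ^ l)"] by simp
  next
    case False
    then have "y (i + j) \<le> smax l y (i + 2 ^ l)"
      using Suc.IH[of "j - 2 ^ l" "i + 2 ^ l"] Suc.prems by simp
    then show ?thesis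
      using ramp_nonneg[of "smax l y i - smax l y (i + 2 ^ l)"] by simp
  qed
qed simp

text \<open>Each level exceeds the larger child by at most the half-width \<open>w\<close>.\<close>

lemma smax_le:
  assumes "\<And>j. j < 2 ^ l \<Longrightarrow> y (i + j) \<le> M"
  shows "smax l y i \<le> M + w * l"
  using assms
proof (induction l arbitrary: i)
  case (Suc l)
  have "smax l y i \<le> M + w * l" using Suc.prems by (intro Suc.IH) simp
  moreover have "smax l y (i + 2 ^ l) \<le> M + w * l"
    using Suc.prems[of "2 ^ l + j" for j] by (intro Suc.IH) (simp add: add.assoc)
  ultimately show ?case
    using ramp_le[of "smax l y i - smax l y (i + 2 ^ l)"] by (auto simp: algebra_simps max_def split: if_splits)
qed simp

text \<open>The second alternative of the conclusion is impossible at a node above a maximal leaf.\<close>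
lemma smax_cong_or_small:
  assumes "\<And>j. j < 2 ^ l \<Longrightarrow> y (i + j) = y' (i + j) \<or> y (i + j) \<le> M \<and> y' (i + j) \<le> M"
  shows "smax l y i = smax l y' i \<or> smax l y i \<le> M + 2 * w * l \<and> smax l y' i \<le> M + 2 * w * l"
  using assms
proof (induction l arbitrary: i)
  case (Suc l)
  let ?a = "smax l y i" and ?a' = "smax l y' i"
  let ?b = "smax l y (i + 2 ^ l)" and ?b' = "smax l y' (i + 2 ^ l)"
  let ?s = "M + 2 * w * l"
  have a: "?a = ?a' \<or> ?a \<le> ?s \<and> ?a' \<le> ?s" using Suc.prems by (intro Suc.IH) simp
  have b: "?b = ?b' \<or> ?b \<le> ?s \<and> ?b' \<le> ?s"
    using Suc.prems[of "2 ^ l + j" for j] by (intro Suc.IH) (simp add: add.assoc)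
  have s: "M + 2 * w * real (Suc l) = ?s + 2 * w" by (simp add: algebra_simps)
  have up: "v + \<phi> (u - v) \<le> ?s + 2 * w" if "u \<le> ?s + w" "v \<le> ?s + w" for u v
    using ramp_le[of "u - v"] that by (auto simp: max_def split: if_splits)
  \<comment> \<open>Besides agreement of both children, either all four values are at most
    \<open>?s + w\<close>, and the node stays below \<open>?s + 2 * w\<close>, or one child is
    unchanged and leads both versions of its sibling by more than \<open>w\<close>. In the latter
    case \<phi> is outside its transition zone and the node is exactly the leading child.\<close>
  consider "?a = ?a'" "?b = ?b'" | "?a \<le> ?s + w" "?a' \<le> ?s + w" "?b \<le> ?s + w" "?b' \<le> ?s + w"
    | "?a = ?a'" "?a > ?s + w" "?b \<le> ?s" "?b' \<le> ?s" | "?b = ?b'" "?b > ?s + w" "?a \<le> ?s" "?a' \<le> ?s"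
    using a b w_nonneg by linarith
  then show ?case
  proof cases
    case 2
    then show ?thesis using up unfolding s by simp
  next
    case 3
    then show ?thesis using ramp_high[of "?a - ?b"] ramp_high[of "?a' - ?b'"] by simp
  next
    case 4
    then show ?thesis using ramp_low[of "?a - ?b"] ramp_low[of "?a' - ?b'"] by simp
  qed simp
qed simp

lemma smax_local:
  assumes j: "j < 2 ^ l" "y j = y' j" and M: "M + 2 * w * l < y j"
    and eq: "\<And>j. j < 2 ^ l \<Longrightarrow> y j = y' j \<or> y j \<le> M \<and> y' j \<le> M"
  shows "smax l y 0 = smax l y' 0"
  using smax_cong_or_small[of l y 0 y' M] smax_ge[of j l y 0] assms by auto

text \<open>The map sending \<open>a\<close>, \<open>b\<close> to \<open>b + \<phi> (a - b)\<close>
  is jointly convex and increasing in both arguments, in \<open>b\<close> because \<phi> is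
  1-Lipschitz; such maps preserve convexity.\<close>

lemma convex_on_smax:
  assumes "\<And>i. convex_on S (\<lambda>x. y x i)"
  shows "convex_on S (\<lambda>x. smax l (y x) i)"
proof (induction l arbitrary: i)
  case 0
  then show ?case using assms by simp
next
  case (Suc l)
  let ?f = "\<lambda>x. smax l (y x) i" and ?g = "\<lambda>x. smax l (y x) (i + 2 ^ l)"
  have f: "convex_on S ?f" and g: "convex_on S ?g" by (rule Suc.IH)+
  have mono: "b + \<phi> (a - b) \<le> b' + \<phi> (a' - b')" if "a \<le> a'" "b \<le> b'" for a b a' b'
    using lip_ramp[of "a - b'" "a - b"] mono_ramp[of "a - b'" "a' - b'"] that by simp
  show ?case
  proof (rule convex_onI)
    fix t x y' assume t: "0 < t" "t < (1::real)" and xy: "x \<in> S" "y' \<in> S"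
    let ?z = "(1 - t) *\<^sub>R x + t *\<^sub>R y'"
    have "?f ?z \<le> (1 - t) * ?f x + t * ?f y'" "?g ?z \<le> (1 - t) * ?g x + t * ?g y'"
      using convex_onD[OF f, of t x y'] convex_onD[OF g, of t x y'] t xy by auto
    note mono[OF this]
    also have "(1 - t) * ?f x + t * ?f y' - ((1 - t) * ?g x + t * ?g y') =
        (1 - t) *\<^sub>R (?f x - ?g x) + t *\<^sub>R (?f y' - ?g y')"
      by (simp add: algebra_simps)
    also have "\<phi> \<dots> \<le> (1 - t) * \<phi> (?f x - ?g x) + t * \<phi> (?f y' - ?g y')"
      using convex_onD[OF convex_ramp, of t] t by simp
    finally show "smax (Suc l) (y ?z) i \<le> (1 - t) * smax (Suc l) (y x) i + t * smax (Suc l) (y y') i"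
      by (simp add: algebra_simps)
  qed (use f convex_on_imp_convex in blast)
qed

lemma measurable_smax [measurable]:
  assumes [measurable]: "\<And>i. (\<lambda>x. y x i) \<in> borel_measurable M"
  shows "(\<lambda>x. smax l (y x) i) \<in> borel_measurable M"
proof (induction l arbitrary: i)
  case (Suc l)
  have [measurable]: "\<phi> \<in> borel_measurable borel"
    by (rule borel_measurable_mono) (simp add: mono_def mono_ramp)
  note [measurable] = Suc.IH
  show ?case by simp
qed simp

end


section \<open>Iterated derivatives of compositions\<close>

text \<open>
  A jet lists the iterated derivatives of a function: \<open>J [v\<^sub>1, \<dots>, v\<^sub>k] x\<close> is the \<open>k\<close>-th derivative
  at \<open>x\<close> in the directions \<open>v\<^sub>1, \<dots>, v\<^sub>k\<close>, and \<open>J []\<close> the function itself.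
\<close>

definition jet :: "nat \<Rightarrow> ('a::real_normed_vector list \<Rightarrow> 'a \<Rightarrow> real) \<Rightarrow> bool" where
  "jet n J \<longleftrightarrow> (\<forall>vs x. length vs < n \<longrightarrow> (J vs has_derivative (\<lambda>v. J (v # vs) x)) (at x))"

lemma jetD: "jet n J \<Longrightarrow> length vs < n \<Longrightarrow> (J vs has_derivative (\<lambda>v. J (v # vs) x)) (at x)"
  by (simp add: jet_def)

lemma jet_add: "jet n I \<Longrightarrow> jet n J \<Longrightarrow> jet n (\<lambda>vs x. I vs x + J vs x)"
  unfolding jet_def by (auto intro: has_derivative_add)

lemma jet_diff: "jet n I \<Longrightarrow> jet n J \<Longrightarrow> jet n (\<lambda>vs x. I vs x - J vs x)"
  unfolding jet_def by (auto intro: has_derivative_diff)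

lemma jet_rescale:
  assumes "jet n J"
  shows "jet n (\<lambda>vs x. a * c ^ length vs * J vs (c *\<^sub>R x))"
  unfolding jet_def
proof (intro allI impI)
  fix vs :: "'a list" and x assume "length vs < n"
  then have J: "(J vs has_derivative (\<lambda>v. J (v # vs) (c *\<^sub>R x))) (at (c *\<^sub>R x))"
    using assms by (rule jetD[rotated])
  have "((\<lambda>x. J vs (c *\<^sub>R x)) has_derivative (\<lambda>v. J (c *\<^sub>R v # vs) (c *\<^sub>R x))) (at x)"
    by (rule has_derivative_compose[where f = "\<lambda>x. c *\<^sub>R x" and f' = "\<lambda>v. c *\<^sub>R v", OF _ J]) (auto intro!: derivative_eq_intros)
  moreover have "J (c *\<^sub>R v # vs) (c *\<^sub>R x) = c * J (v # vs) (c *\<^sub>R x)" for v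
    using linear_cmul[OF has_derivative_linear[OF J], of c v] by simp
  ultimately show "((\<lambda>x. a * c ^ length vs * J vs (c *\<^sub>R x)) has_derivative
      (\<lambda>v. a * c ^ length (v # vs) * J (v # vs) (c *\<^sub>R x))) (at x)"
    by (auto intro!: derivative_eq_intros simp: algebra_simps)
qed

definition affine_jet :: "('a::real_normed_vector \<Rightarrow> real) \<Rightarrow> real \<Rightarrow> 'a list \<Rightarrow> 'a \<Rightarrow> real" where
  "affine_jet h c vs x = (case vs of [] \<Rightarrow> h x + c | [v] \<Rightarrow> h v | _ \<Rightarrow> 0)"

lemma jet_affine: "bounded_linear h \<Longrightarrow> jet n (affine_jet h c)"
  unfolding jet_def
proof (intro allI impI)
  fix vs :: "'a list" and x assume h: "bounded_linear h"
  show "(affine_jet h c vs has_derivative (\<lambda>v. affine_jet h c (v # vs) x)) (at x)"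
  proof (cases vs)
    case Nil
    then show ?thesis
      using bounded_linear_imp_has_derivative[OF h] unfolding affine_jet_def
      by (auto intro!: derivative_eq_intros)
  next
    case (Cons v vs')
    then show ?thesis by (cases vs') (auto simp: affine_jet_def[abs_def])
  qed
qed

text \<open>
  Faa di Bruno's formula: the derivatives of a composition are indexed by the partitions of the
  list of directions.
\<close>

primrec cons_block :: "'a \<Rightarrow> 'a list list \<Rightarrow> 'a list list list" where
  "cons_block v [] = []"
| "cons_block v (B # L) = ((v # B) # L) # map ((#) B) (cons_block v L)"

primrec partitions :: "'a list \<Rightarrow> 'a list list list" where
  "partitions [] = [[]]"
| "partitions (v # vs) = concat (map (\<lambda>L. ([v] # L) # cons_block v L) (partitions vs))"

definition comp_jet ::
    "(nat \<Rightarrow> real \<Rightarrow> real) \<Rightarrow> ('a list \<Rightarrow> 'a \<Rightarrow> real) \<Rightarrow> 'a list \<Rightarrow> 'a \<Rightarrow> real" where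
  "comp_jet D J vs x = (\<Sum>L\<leftarrow>partitions vs. D (length L) (J [] x) * (\<Prod>B\<leftarrow>L. J B x))"

lemma length_cons_block [simp]: "length (cons_block v L) = length L"
  by (induction L) auto

lemma cons_block_length: "L' \<in> set (cons_block v L) \<Longrightarrow> length L' = length L"
  by (induction L arbitrary: L') auto

lemma cons_block_mem:
  "L' \<in> set (cons_block v L) \<Longrightarrow> B \<in> set L' \<Longrightarrow> B \<in> set L \<or> (\<exists>B0\<in>set L. B = v # B0)"
proof (induction L arbitrary: L')
  case (Cons C L)
  from Cons.prems(1) consider "L' = (v # C) # L" | L0 where "L' = C # L0" "L0 \<in> set (cons_block v L)"
    by auto
  then show ?case
    by cases (use Cons in auto)
qed simp

lemma Nil_in_partitions [simp]: "[] \<in> set (partitions vs) \<longleftrightarrow> vs = []"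
proof (cases vs)
  case (Cons v vs')
  moreover have "[] \<in> set (cons_block v L) \<Longrightarrow> False" for L
    by (cases L) auto
  ultimately show ?thesis using Cons by auto
qed simp

lemma partitions_length: "L \<in> set (partitions vs) \<Longrightarrow> length L \<le> length vs"
  by (induction vs arbitrary: L) (force dest: cons_block_length)+

lemma partitions_mem:
  "L \<in> set (partitions vs) \<Longrightarrow> B \<in> set L \<Longrightarrow> B \<noteq> [] \<and> length B \<le> length vs \<and> set B \<subseteq> set vs"
proof (induction vs arbitrary: L B)
  case (Cons v vs)
  then show ?case by (fastforce dest: cons_block_mem)
qed simp

text \<open>A crude bound on the Bell numbers: a partition with \<open>m\<close> blocks extends in
  \<open>m + 1\<close> ways, and \<open>m\<close> is at most the number of directions.\<close>

lemma length_partitions: "length (partitions vs) \<le> fact (length vs)"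
proof (induction vs)
  case (Cons v vs)
  have "length (partitions (v # vs)) = (\<Sum>L\<leftarrow>partitions vs. Suc (length L))"
    by (simp add: length_concat comp_def)
  also have "\<dots> \<le> (\<Sum>L\<leftarrow>partitions vs. Suc (length vs))"
    by (intro sum_list_mono) (use partitions_length in auto)
  also have "\<dots> \<le> fact (length vs) * Suc (length vs)"
    using mult_right_mono[OF Cons, of "Suc (length vs)"] by (simp add: sum_list_triv)
  finally show ?case by (simp add: algebra_simps)
qed simp

text \<open>Isolates the one-block partition, the only one whose term involves the derivative of
  full order, so that all other terms can be estimated by lower derivatives.\<close>

lemma partitions_split:
  assumes "vs \<noteq> []"
  shows "\<exists>Ls Rs. partitions vs = Ls @ [[vs]] @ Rs \<and>
    (\<forall>L\<in>set (Ls @ Rs). \<forall>B\<in>set L. length B < length vs)"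
  using assms
proof (induction vs)
  case (Cons v vs)
  show ?case
  proof (cases "vs = []")
    case False
    then obtain Ls Rs where p: "partitions vs = Ls @ [[vs]] @ Rs"
      and less: "\<forall>L\<in>set (Ls @ Rs). \<forall>B\<in>set L. length B < length vs"
      using Cons.IH by blast
    let ?c = "\<lambda>Ls. concat (map (\<lambda>L. ([v] # L) # cons_block v L) Ls)"
    \<comment> \<open>The old one-block partition produces \<open>[[v], vs]\<close> and the new
      one-block partition; the former has only shorter blocks because \<open>vs\<close> is nonempty,
      and joins the left part.\<close>
    have "partitions (v # vs) = (?c Ls @ [[[v], vs]]) @ [[v # vs]] @ ?c Rs"
      by (simp add: p)
    moreover have "length B < length (v # vs)"
      if "L \<in> set ((?c Ls @ [[[v], vs]]) @ ?c Rs)" "B \<in> set L" for L B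
    proof -
      have "L = [[v], vs] \<or> (\<exists>L0\<in>set (Ls @ Rs). L \<in> set (([v] # L0) # cons_block v L0))"
        using that(1) by auto
      then consider "L = [[v], vs]"
        | L0 where "L0 \<in> set (Ls @ Rs)" "L \<in> set (([v] # L0) # cons_block v L0)"
        by blast
      then show ?thesis
      proof cases
        case 1
        then show ?thesis using that(2) False by auto
      next
        case 2
        then have "B = [v] \<or> B \<in> set L0 \<or> (\<exists>B0\<in>set L0. B = v # B0)"
          using that(2) by (auto dest: cons_block_mem)
        moreover have "length B0 < length vs" if "B0 \<in> set L0" for B0
          using less 2(1) that by blast
        ultimately show ?thesis using False by (auto intro: less_SucI)
      qed
    qed
    ultimately show ?thesis by blast
  qed (auto intro!: exI[of _ "[]"])
qed simp

lemma has_derivative_sum_list: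
  assumes "\<And>L. L \<in> set Ls \<Longrightarrow> (f L has_derivative f' L) F"
  shows "((\<lambda>x. \<Sum>L\<leftarrow>Ls. f L x) has_derivative (\<lambda>v. \<Sum>L\<leftarrow>Ls. f' L v)) F"
  using assms by (induction Ls) (auto intro!: has_derivative_add)

lemma has_derivative_prod_jet:
  assumes J: "jet n J" and "\<And>B. B \<in> set L \<Longrightarrow> length B < n"
  shows "((\<lambda>x. \<Prod>B\<leftarrow>L. J B x) has_derivative (\<lambda>v. \<Sum>L'\<leftarrow>cons_block v L. \<Prod>B\<leftarrow>L'. J B x)) (at x)"
  using assms(2)
proof (induction L)
  case (Cons B L)
  have "((\<lambda>x. J B x * (\<Prod>B\<leftarrow>L. J B x)) has_derivative
      (\<lambda>v. J B x * (\<Sum>L'\<leftarrow>cons_block v L. \<Prod>B\<leftarrow>L'. J B x) + J (v # B) x * (\<Prod>B\<leftarrow>L. J B x))) (at x)"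
    using Cons by (intro has_derivative_mult jetD[OF J]) auto
  then show ?case
    by (simp add: comp_def sum_list_const_mult algebra_simps)
qed simp

lemma sum_list_concat_map:
  "(\<Sum>x\<leftarrow>concat (map g xs). f x) = (\<Sum>x\<leftarrow>xs. \<Sum>y\<leftarrow>g x. f y :: real)"
  by (induction xs) auto

text \<open>Differentiating the summand of a partition \<open>L\<close> in direction
  \<open>v\<close> reproduces the recursion of \<open>partitions\<close>: the chain rule on the
  factor \<open>D (length L)\<close> opens the block \<open>[v]\<close>, and the product rule
  inserts \<open>v\<close> into one of the existing blocks.\<close>

lemma jet_comp:
  assumes J: "jet n J" and D: "\<And>j s. j < n \<Longrightarrow> (D j has_real_derivative D (Suc j) s) (at s)"
  shows "jet n (comp_jet D J)"
  unfolding jet_def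
proof (intro allI impI)
  fix vs :: "'a list" and x assume n: "length vs < n"
  have deriv: "((\<lambda>x. D (length L) (J [] x) * (\<Prod>B\<leftarrow>L. J B x)) has_derivative
      (\<lambda>v. \<Sum>L'\<leftarrow>([v] # L) # cons_block v L. D (length L') (J [] x) * (\<Prod>B\<leftarrow>L'. J B x))) (at x)"
    if L: "L \<in> set (partitions vs)" for L
  proof -
    have "length L < n" using partitions_length[OF L] n by simp
    then have "(D (length L) has_derivative (*) (D (Suc (length L)) (J [] x))) (at (J [] x))"
      using D by (simp add: has_field_derivative_def)
    moreover have "(J [] has_derivative (\<lambda>v. J [v] x)) (at x)"
      using jetD[OF J, of "[]"] n by (cases n) auto
    ultimately have 1: "((\<lambda>x. D (length L) (J [] x)) has_derivative
        (\<lambda>v. D (Suc (length L)) (J [] x) * J [v] x)) (at x)"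
      using has_derivative_compose by blast
    have 2: "((\<lambda>x. \<Prod>B\<leftarrow>L. J B x) has_derivative
        (\<lambda>v. \<Sum>L'\<leftarrow>cons_block v L. \<Prod>B\<leftarrow>L'. J B x)) (at x)"
      using partitions_mem[OF L] n by (intro has_derivative_prod_jet[OF J]) fastforce
    have "(\<Sum>L'\<leftarrow>cons_block v L. D (length L') (J [] x) * (\<Prod>B\<leftarrow>L'. J B x)) =
        D (length L) (J [] x) * (\<Sum>L'\<leftarrow>cons_block v L. \<Prod>B\<leftarrow>L'. J B x)" for v
      unfolding sum_list_const_mult[symmetric]
      by (intro arg_cong[where f = sum_list] map_cong) (auto dest: cons_block_length)
    then show ?thesis
      using has_derivative_mult[OF 1 2] by (simp add: algebra_simps)
  qed
  have "(comp_jet D J vs has_derivative (\<lambda>v. \<Sum>L\<leftarrow>partitions vs.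
      \<Sum>L'\<leftarrow>([v] # L) # cons_block v L. D (length L') (J [] x) * (\<Prod>B\<leftarrow>L'. J B x))) (at x)"
    unfolding comp_jet_def[abs_def] by (rule has_derivative_sum_list) (rule deriv)
  moreover have "comp_jet D J (v # vs) x = (\<Sum>L\<leftarrow>partitions vs.
      \<Sum>L'\<leftarrow>([v] # L) # cons_block v L. D (length L') (J [] x) * (\<Prod>B\<leftarrow>L'. J B x))" for v
    unfolding comp_jet_def partitions.simps sum_list_concat_map by simp
  ultimately show "(comp_jet D J vs has_derivative (\<lambda>v. comp_jet D J (v # vs) x)) (at x)"
    by simp
qed

lemma abs_prod_list_le:
  fixes b :: real
  assumes "1 \<le> b" "length L \<le> k" "\<And>B. B \<in> set L \<Longrightarrow> \<bar>f B\<bar> \<le> b"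
  shows "\<bar>\<Prod>B\<leftarrow>L. f B\<bar> \<le> b ^ k"
proof -
  have "\<bar>\<Prod>B\<leftarrow>L. f B\<bar> \<le> b ^ length L"
    using assms(3) by (induction L) (use assms(1) in \<open>auto simp: abs_mult intro!: mult_mono\<close>)
  also have "\<dots> \<le> b ^ k" using assms by (intro power_increasing) auto
  finally show ?thesis .
qed

text \<open>Only the term of the one-block partition contains a derivative of full order.\<close>
lemma comp_jet_leading:
  assumes vs: "vs \<noteq> []" "set vs \<subseteq> U" and b: "1 \<le> b"
    and D: "\<And>j s. 1 \<le> j \<Longrightarrow> j \<le> length vs \<Longrightarrow> \<bar>D j s\<bar> \<le> C"
    and J: "\<And>B. B \<noteq> [] \<Longrightarrow> set B \<subseteq> U \<Longrightarrow> length B < length vs \<Longrightarrow> \<bar>J B x\<bar> \<le> b"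
  shows "\<bar>comp_jet D J vs x - D 1 (J [] x) * J vs x\<bar> \<le> fact (length vs) * (C * b ^ length vs)"
proof -
  let ?k = "length vs"
  let ?m = "\<lambda>L. D (length L) (J [] x) * (\<Prod>B\<leftarrow>L. J B x)"
  obtain Ls Rs where p: "partitions vs = Ls @ [[vs]] @ Rs"
    and less: "\<And>L B. L \<in> set (Ls @ Rs) \<Longrightarrow> B \<in> set L \<Longrightarrow> length B < ?k"
    using partitions_split[OF vs(1)] by blast
  have "0 \<le> \<bar>D 1 0\<bar>" by simp
  also have "\<dots> \<le> C" using D[of 1 0] vs(1) by (cases vs) auto
  finally have C: "0 \<le> C" .
  have m: "\<bar>?m L\<bar> \<le> C * b ^ ?k" if L: "L \<in> set (Ls @ Rs)" for L
  proof -
    have L': "L \<in> set (partitions vs)" using L by (auto simp: p)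
    have "L \<noteq> []"
    proof
      assume "L = []"
      with L' have "[] \<in> set (partitions vs)" by simp
      with vs(1) show False by (simp add: Nil_in_partitions)
    qed
    then have "1 \<le> length L" by (cases L) auto
    moreover have "\<bar>J B x\<bar> \<le> b" if "B \<in> set L" for B
      using partitions_mem[OF L' that] less[OF L that] vs(2) by (intro J) blast+
    then have "\<bar>\<Prod>B\<leftarrow>L. J B x\<bar> \<le> b ^ ?k"
      by (rule abs_prod_list_le[OF b partitions_length[OF L']])
    ultimately show ?thesis
      using D[of "length L"] partitions_length[OF L'] C by (simp add: abs_mult mult_mono)
  qed
  have "comp_jet D J vs x - D 1 (J [] x) * J vs x = (\<Sum>L\<leftarrow>Ls @ Rs. ?m L)"
    by (simp add: comp_jet_def p)
  also have "\<bar>\<dots>\<bar> \<le> (\<Sum>L\<leftarrow>Ls @ Rs. \<bar>?m L\<bar>)"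
    using sum_list_abs[of "map ?m (Ls @ Rs)"] by (simp add: comp_def)
  also have "\<dots> \<le> (\<Sum>L\<leftarrow>Ls @ Rs. C * b ^ ?k)"
    by (intro sum_list_mono m)
  also have "\<dots> = real (length (Ls @ Rs)) * (C * b ^ ?k)"
    by (simp add: sum_list_triv algebra_simps)
  also have "\<dots> \<le> fact ?k * (C * b ^ ?k)"
  proof (rule mult_right_mono)
    have "length (Ls @ Rs) \<le> fact ?k"
      using length_partitions[of vs] by (simp add: p)
    then show "real (length (Ls @ Rs)) \<le> fact ?k"
      using of_nat_mono by fastforce
  qed (use C b in simp)
  finally show ?thesis .
qed

section \<open>Derivatives of the soft maximum\<close>

primrec smax_jet :: "(nat \<Rightarrow> real \<Rightarrow> real) \<Rightarrow> nat \<Rightarrow> (nat \<Rightarrow> 'a list \<Rightarrow> 'a \<Rightarrow> real) \<Rightarrow> nat \<Rightarrow>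
    'a list \<Rightarrow> 'a \<Rightarrow> real" where
  "smax_jet D 0 Y i = Y i"
| "smax_jet D (Suc l) Y i = (\<lambda>vs x. smax_jet D l Y (i + 2 ^ l) vs x +
     comp_jet D (\<lambda>vs x. smax_jet D l Y i vs x - smax_jet D l Y (i + 2 ^ l) vs x) vs x)"

lemma jet_smax_jet:
  assumes "\<And>i. jet n (Y i)" "\<And>j s. j < n \<Longrightarrow> (D j has_real_derivative D (Suc j) s) (at s)"
  shows "jet n (smax_jet D l Y i)"
proof (induction l arbitrary: i)
  case (Suc l)
  show ?case
    unfolding smax_jet.simps by (intro jet_add jet_comp jet_diff Suc.IH assms(2))
qed (use assms in simp)

lemma (in ramp) smax_jet_Nil:
  "D 0 = \<phi> \<Longrightarrow> smax_jet D l Y i [] x = smax l (\<lambda>i. Y i [] x) i"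
  by (induction l arbitrary: i) (auto simp: comp_jet_def)

text \<open>With \<theta> the slope of the ramp at a node, the full-order derivative there is
  \<theta> times that of one child plus \<open>1 - \<theta>\<close> times that of the other, up to
  the remainder of \<open>comp_jet_leading\<close>. The leaf bound 1 is thus preserved and each
  level adds one remainder. Lower derivatives are bounded by \<open>b / 2\<close> so that the
  difference of two children is bounded by \<open>b\<close>.\<close>

lemma smax_jet_step:
  assumes D1: "\<And>s. 0 \<le> D 1 s \<and> D 1 s \<le> 1"
    and D: "\<And>j s. 1 \<le> j \<Longrightarrow> j \<le> length vs \<Longrightarrow> \<bar>D j s\<bar> \<le> C"
    and vs: "vs \<noteq> []" "set vs \<subseteq> U" and b: "1 \<le> b"
    and Y: "\<And>i B. B \<noteq> [] \<Longrightarrow> set B \<subseteq> U \<Longrightarrow> \<bar>Y i B x\<bar> \<le> 1"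
    and low: "\<And>l' i B. l' < l \<Longrightarrow> B \<noteq> [] \<Longrightarrow> set B \<subseteq> U \<Longrightarrow> length B < length vs \<Longrightarrow>
      \<bar>smax_jet D l' Y i B x\<bar> \<le> b / 2"
  shows "\<bar>smax_jet D l Y i vs x\<bar> \<le> 1 + l * (fact (length vs) * (C * b ^ length vs))"
  using low
proof (induction l arbitrary: i)
  case 0
  then show ?case using Y[OF vs] by simp
next
  case (Suc l)
  let ?R = "fact (length vs) * (C * b ^ length vs)"
  let ?f = "smax_jet D l Y i" and ?g = "smax_jet D l Y (i + 2 ^ l)"
  let ?u = "\<lambda>vs x. ?f vs x - ?g vs x"
  define \<theta> where "\<theta> = D 1 (?u [] x)"
  have IH: "\<bar>smax_jet D l Y i vs x\<bar> \<le> 1 + l * ?R" for i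
    by (intro Suc.IH Suc.prems) auto
  have "\<bar>?u B x\<bar> \<le> b" if "B \<noteq> []" "set B \<subseteq> U" "length B < length vs" for B
    using Suc.prems[OF _ that, of l i] Suc.prems[OF _ that, of l "i + 2 ^ l"] by linarith
  then have R: "\<bar>comp_jet D ?u vs x - \<theta> * ?u vs x\<bar> \<le> ?R"
    unfolding \<theta>_def by (intro comp_jet_leading[OF vs b D])
  have \<theta>: "0 \<le> \<theta>" "\<theta> \<le> 1" using D1 by (auto simp: \<theta>_def)
  have "\<bar>?g vs x + \<theta> * ?u vs x\<bar> = \<bar>\<theta> * ?f vs x + (1 - \<theta>) * ?g vs x\<bar>"
    by (simp add: algebra_simps)
  also have "\<dots> \<le> \<theta> * \<bar>?f vs x\<bar> + (1 - \<theta>) * \<bar>?g vs x\<bar>"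
    using abs_triangle_ineq[of "\<theta> * ?f vs x" "(1 - \<theta>) * ?g vs x"] \<theta> by (simp add: abs_mult)
  also have "\<dots> \<le> 1 + l * ?R"
    using \<theta> IH by (intro convex_bound_le) auto
  finally show ?case using R by (simp add: algebra_simps)
qed

text \<open>
  By the convex combination in \<open>smax_jet_step\<close> each level only adds a polynomial in the lower
  derivatives, so the bounds grow polynomially in the depth rather than exponentially.
\<close>
lemma smax_jet_bound:
  assumes D1: "\<And>s. 0 \<le> D 1 s \<and> D 1 s \<le> 1"
    and D: "\<And>j. 1 \<le> j \<Longrightarrow> j \<le> k \<Longrightarrow> \<exists>C. \<forall>s. \<bar>D j s\<bar> \<le> C"
  shows "\<exists>C p. 1 \<le> C \<and> (\<forall>(Y::nat \<Rightarrow> 'a list \<Rightarrow> 'a \<Rightarrow> real) U x.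
    (\<forall>i B. B \<noteq> [] \<longrightarrow> set B \<subseteq> U \<longrightarrow> \<bar>Y i B x\<bar> \<le> 1) \<longrightarrow>
    (\<forall>l i vs. vs \<noteq> [] \<longrightarrow> length vs \<le> k \<longrightarrow> set vs \<subseteq> U \<longrightarrow>
       \<bar>smax_jet D l Y i vs x\<bar> \<le> C * (1 + real l) ^ p))"
  using D
proof (induction k)
  case 0
  then show ?case by (auto intro!: exI[of _ 1])
next
  case (Suc k)
  then obtain C p where C: "1 \<le> C" and IH: "\<And>(Y::nat \<Rightarrow> 'a list \<Rightarrow> 'a \<Rightarrow> real) U x l i vs.
      (\<And>i B. B \<noteq> [] \<Longrightarrow> set B \<subseteq> U \<Longrightarrow> \<bar>Y i B x\<bar> \<le> 1) \<Longrightarrow> vs \<noteq> [] \<Longrightarrow> length vs \<le> k \<Longrightarrow> set vs \<subseteq> U \<Longrightarrow>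
       \<bar>smax_jet D l Y i vs x\<bar> \<le> C * (1 + real l) ^ p"
    by (metis le_SucI)
  have "\<exists>E. \<forall>j\<in>{1..Suc k}. \<forall>s. \<bar>D j s\<bar> \<le> E j"
    using Suc.prems by (intro bchoice) simp
  then obtain E where "\<forall>j\<in>{1..Suc k}. \<forall>s. \<bar>D j s\<bar> \<le> E j" by blast
  then have E: "\<bar>D j s\<bar> \<le> E j" if "1 \<le> j" "j \<le> Suc k" for j s using that by simp
  define C\<^sub>0 where "C\<^sub>0 = (\<Sum>j\<in>{1..Suc k}. \<bar>E j\<bar>)"
  have C0: "\<bar>D j s\<bar> \<le> C\<^sub>0" if "1 \<le> j" "j \<le> Suc k" for j s
    using E[OF that, of s] member_le_sum[of j "{1..Suc k}" "\<lambda>j. \<bar>E j\<bar>"] that by (auto simp: C\<^sub>0_def)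
  have C0_nonneg: "0 \<le> C\<^sub>0" by (simp add: C\<^sub>0_def sum_nonneg)
  \<comment> \<open>\<open>M\<close> collects the remainder of one level without its power of
    \<open>1 + l\<close>. Raising the lower-order bound to the power \<open>Suc k\<close> multiplies
    the exponent \<open>p\<close>, and summing over \<open>l\<close> levels costs the additional
    factor counted by \<open>Suc\<close> in \<open>p'\<close>.\<close>
  define M where "M = fact (Suc k) * (C\<^sub>0 * (2 * C) ^ Suc k)"
  have M: "0 \<le> M" using C C0_nonneg by (simp add: M_def)
  define p' where "p' = Suc (p * Suc k)"
  have *: "\<bar>smax_jet D l Y i vs x\<bar> \<le> (C + M) * (1 + real l) ^ p'"
    if Y: "\<And>i B. B \<noteq> [] \<Longrightarrow> set B \<subseteq> U \<Longrightarrow> \<bar>Y i B x\<bar> \<le> 1"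
      and vs: "vs \<noteq> []" "length vs \<le> Suc k" "set vs \<subseteq> U"
    for Y :: "nat \<Rightarrow> 'a list \<Rightarrow> 'a \<Rightarrow> real" and U x l i vs
  proof (cases "length vs \<le> k")
    case True
    have "\<bar>smax_jet D l Y i vs x\<bar> \<le> C * (1 + real l) ^ p"
      using IH[of U Y x vs l i] Y vs True by blast
    also have "\<dots> \<le> (C + M) * (1 + real l) ^ p'"
      using C M by (intro mult_mono power_increasing) (auto simp: p'_def)
    finally show ?thesis .
  next
    case False
    then have len: "length vs = Suc k" using vs(2) by simp
    define b where "b = 2 * (C * (1 + real l) ^ p)"
    have "1 * 1 \<le> C * (1 + real l) ^ p"
      using C by (intro mult_mono one_le_power) auto
    then have b: "1 \<le> b" by (simp add: b_def)
    have low: "\<bar>smax_jet D l' Y i B x\<bar> \<le> b / 2"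
      if "l' < l" "B \<noteq> []" "set B \<subseteq> U" "length B < length vs" for l' i B
    proof -
      have "\<bar>smax_jet D l' Y i B x\<bar> \<le> C * (1 + real l') ^ p"
        using IH[of U Y x B l' i] Y that len by auto
      also have "\<dots> \<le> C * (1 + real l) ^ p"
        using C that by (intro mult_left_mono power_mono) auto
      finally show ?thesis by (simp add: b_def)
    qed
    have "\<bar>smax_jet D l Y i vs x\<bar> \<le> 1 + l * (fact (length vs) * (C\<^sub>0 * b ^ length vs))"
      using C0 len by (intro smax_jet_step[OF D1 _ vs(1,3) b Y low]) auto
    also have "b ^ length vs = (2 * C) ^ Suc k * (1 + real l) ^ (p * Suc k)"
      unfolding len b_def power_mult by (simp add: power_mult_distrib)
    also have "1 + l * (fact (length vs) * (C\<^sub>0 * \<dots>)) = 1 + M * (l * (1 + real l) ^ (p * Suc k))"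
      unfolding len M_def by (simp add: algebra_simps del: fact_Suc)
    also have "\<dots> \<le> C * (1 + real l) ^ p' + M * (1 + real l) ^ p'"
    proof (rule add_mono)
      have "1 * 1 \<le> C * (1 + real l) ^ p'"
        using C by (intro mult_mono one_le_power) auto
      then show "1 \<le> C * (1 + real l) ^ p'" by simp
      show "M * (l * (1 + real l) ^ (p * Suc k)) \<le> M * (1 + real l) ^ p'"
        using M by (intro mult_left_mono) (auto simp: p'_def intro!: mult_right_mono)
    qed
    finally show ?thesis by (simp add: algebra_simps)
  qed
  moreover have "1 \<le> C + M" using C M by simp
  ultimately show ?case by blast
qed

text \<open>Turns a bound of one order into a Lipschitz bound of the order below. Only the direction
  of the segment has to be controlled, so the bound can be stated for unit vectors of an arbitrary
  norm.\<close>

lemma jet_mean_value: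
  assumes J: "jet n J" "length vs < n"
    and b: "\<And>z. \<bar>J (w # vs) z\<bar> \<le> b" and t: "0 \<le> t"
  shows "\<bar>J vs (x + t *\<^sub>R w) - J vs x\<bar> \<le> b * t"
proof (cases "t = 0")
  case False
  have "((\<lambda>s. J vs (x + s *\<^sub>R w)) has_real_derivative J (w # vs) (x + s *\<^sub>R w)) (at s)" for s
  proof -
    have "((\<lambda>s. J vs (x + s *\<^sub>R w)) has_derivative (\<lambda>h. J (h *\<^sub>R w # vs) (x + s *\<^sub>R w))) (at s)"
      by (rule has_derivative_compose[where f = "\<lambda>s. x + s *\<^sub>R w", OF _ jetD[OF J]]) (auto intro!: derivative_eq_intros)
    moreover have "J (h *\<^sub>R w # vs) (x + s *\<^sub>R w) = J (w # vs) (x + s *\<^sub>R w) * h" for h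
      using linear_cmul[OF has_derivative_linear[OF jetD[OF J, where x = "x + s *\<^sub>R w"]], of h w]
      by (simp add: mult.commute)
    ultimately show ?thesis by (simp add: has_field_derivative_def)
  qed
  then obtain s where "J vs (x + t *\<^sub>R w) - J vs (x + 0 *\<^sub>R w) = (t - 0) * J (w # vs) (x + s *\<^sub>R w)"
    using MVT2[of 0 t "\<lambda>s. J vs (x + s *\<^sub>R w)" "\<lambda>s. J (w # vs) (x + s *\<^sub>R w)"] t False by auto
  then show ?thesis
    using mult_left_mono[OF b t] t by (simp add: abs_mult mult.commute)
qed simp


section \<open>The space of finitely supported sequences\<close>

lemma lookup_scaleR [simp]:
  fixes x :: "'a \<Rightarrow>\<^sub>0 'b::real_vector"
  shows "Poly_Mapping.lookup (a *\<^sub>R x) i = a *\<^sub>R Poly_Mapping.lookup x i"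
proof -
  have "finite {i. a *\<^sub>R Poly_Mapping.lookup x i \<noteq> 0}"
    by (rule finite_subset[OF _ finite_keys[of x]]) (auto simp: in_keys_iff)
  then show ?thesis by (simp add: scaleR_poly_mapping_def)
qed

lemma norm_vec_eq:
  fixes x :: vec
  assumes "finite I" "Poly_Mapping.keys x \<subseteq> I"
  shows "norm x = (\<Sum>i\<in>I. \<bar>Poly_Mapping.lookup x i\<bar>)"
proof -
  have "norm x = (\<Sum>i\<in>Poly_Mapping.keys x. \<bar>Poly_Mapping.lookup x i\<bar>)"
    by (simp add: norm_poly_mapping_def dist_poly_mapping_def)
  also have "\<dots> = (\<Sum>i\<in>I. \<bar>Poly_Mapping.lookup x i\<bar>)"
    using assms by (intro sum.mono_neutral_left) (auto simp: in_keys_iff)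
  finally show ?thesis .
qed

lemma abs_lookup_le_norm: "\<bar>Poly_Mapping.lookup x i\<bar> \<le> norm x" for x :: vec
proof (cases "i \<in> Poly_Mapping.keys x")
  case True
  then show ?thesis
    using member_le_sum[of i "Poly_Mapping.keys x" "\<lambda>i. \<bar>Poly_Mapping.lookup x i\<bar>"]
    by (simp add: norm_vec_eq[OF finite_keys order_refl])
qed (simp add: in_keys_iff)

lemma bounded_linear_lookup: "bounded_linear (\<lambda>x::vec. Poly_Mapping.lookup x i)"
  by (rule bounded_linear_intro[where K = 1]) (auto simp: lookup_add abs_lookup_le_norm)

lemma continuous_on_lookup [continuous_intros]:
  "continuous_on S f \<Longrightarrow> continuous_on S (\<lambda>x. Poly_Mapping.lookup (f x :: vec) i)"
  by (rule bounded_linear.continuous_on[OF bounded_linear_lookup])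

lemma bounded_linear_dotp: "bounded_linear (dotp z)"
  unfolding dotp_def[abs_def]
  by (intro bounded_linear_sum bounded_linear_compose[OF bounded_linear_mult_right bounded_linear_lookup])

lemma dotp_simps [simp]:
  "dotp z (x + y) = dotp z x + dotp z y" "dotp z (a *\<^sub>R x) = a * dotp z x"
  "dotp z (- x) = - dotp z x" "dotp z (x - y) = dotp z x - dotp z y" "dotp z 0 = 0" "dotp 0 x = 0"
  using bounded_linear.linear[OF bounded_linear_dotp, of z]
  by (simp_all add: linear_add linear_cmul linear_neg linear_diff linear_0) (simp add: dotp_def)

lemma Rd_iff: "x \<in> Rd d \<longleftrightarrow> (\<forall>i\<ge>d. Poly_Mapping.lookup x i = 0)"
  by (auto simp: Rd_def subset_iff in_keys_iff) (meson not_le)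

lemma subspace_Rd: "subspace (Rd d)"
  by (auto simp: subspace_def Rd_iff lookup_add)

lemma zero_in_Rd [simp]: "0 \<in> Rd d"
  by (simp add: Rd_iff)

lemma closed_Rd: "closed (Rd d)"
proof -
  have "Rd d = (\<Inter>i\<in>{d..}. {x. Poly_Mapping.lookup x i = 0})"
    by (auto simp: Rd_iff)
  then show ?thesis
    by (simp add: closed_INT closed_Collect_eq continuous_intros)
qed

lemma dotp_Rd: "z \<in> Rd d \<Longrightarrow> dotp z x = (\<Sum>i<d. Poly_Mapping.lookup z i * Poly_Mapping.lookup x i)"
  unfolding dotp_def by (rule sum.mono_neutral_left) (auto simp: Rd_def in_keys_iff)

lemma Rd_expand:
  assumes "x \<in> Rd d"
  shows "x = (\<Sum>i<d. Poly_Mapping.lookup x i *\<^sub>R Poly_Mapping.single i 1)"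
proof (rule poly_mapping_eqI)
  fix j
  show "Poly_Mapping.lookup x j =
      Poly_Mapping.lookup (\<Sum>i<d. Poly_Mapping.lookup x i *\<^sub>R Poly_Mapping.single i 1) j"
    using assms by (auto simp: lookup_sum lookup_single when_def Rd_iff
      if_distrib[of "(*) _"] not_less cong: if_cong)
qed

text \<open>The ambient space is infinite-dimensional, so closed and bounded is not enough. Each
  further coordinate presents the cube as a continuous image of a smaller cube times an
  interval.\<close>

lemma compact_cube: "compact {x \<in> Rd d. \<forall>i. \<bar>Poly_Mapping.lookup x i\<bar> \<le> r}"
proof (cases "0 \<le> r")
  case True
  show ?thesis
  proof (induction d)
    case 0
    have "{x \<in> Rd 0. \<forall>i. \<bar>Poly_Mapping.lookup x i\<bar> \<le> r} = {0}"
      using True by (auto simp: Rd_def)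
    then show ?case by simp
  next
    case (Suc d)
    let ?C = "\<lambda>d. {x \<in> Rd d. \<forall>i. \<bar>Poly_Mapping.lookup x i\<bar> \<le> r}"
    let ?f = "\<lambda>(x::vec, t). x + t *\<^sub>R Poly_Mapping.single d (1::real)"
    have "x \<in> ?f ` (?C d \<times> {- r..r})" if x: "x \<in> ?C (Suc d)" for x
    proof
      let ?t = "Poly_Mapping.lookup x d"
      let ?y = "x - ?t *\<^sub>R Poly_Mapping.single d 1"
      show "x = ?f (?y, ?t)" by simp
      show "(?y, ?t) \<in> ?C d \<times> {- r..r}"
      proof -
        have "Poly_Mapping.lookup x i = 0" if "d < i" for i
          using x that by (simp add: Rd_iff Suc_le_eq)
        then have "Poly_Mapping.lookup ?y i = (if d \<le> i then 0 else Poly_Mapping.lookup x i)" for i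
          by (auto simp: lookup_minus lookup_single when_def)
        moreover have b: "\<bar>Poly_Mapping.lookup x i\<bar> \<le> r" for i
          using x by simp
        ultimately have "?y \<in> ?C d" using True by (simp add: Rd_iff)
        moreover have "?t \<in> {- r..r}" using b[of d] by (simp add: abs_le_iff)
        ultimately show ?thesis by blast
      qed
    qed
    moreover have "?f p \<in> ?C (Suc d)" if "p \<in> ?C d \<times> {- r..r}" for p
    proof -
      have p: "fst p \<in> ?C d" "snd p \<in> {- r..r}" using that by auto
      then have "Poly_Mapping.lookup (?f p) i =
          (if i = d then snd p else Poly_Mapping.lookup (fst p) i)" for i
        by (simp add: case_prod_unfold Rd_iff lookup_add lookup_single when_def)
      then show ?thesis using p by (auto simp: Rd_iff abs_le_iff)
    qed
    ultimately have "?C (Suc d) = ?f ` (?C d \<times> {- r..r})" by blast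
    moreover have "continuous_on (?C d \<times> {- r..r}) ?f"
      by (auto simp: case_prod_unfold intro!: continuous_intros)
    ultimately show ?case
      using compact_continuous_image[OF _ compact_Times[OF Suc.IH compact_Icc]] by simp
  qed
next
  case False
  then have "\<not> \<bar>t\<bar> \<le> r" for t :: real by linarith
  then show ?thesis by simp
qed

text \<open>Cubes are totally bounded, hence have finite nets of every mesh. Choosing a point of
  \<open>A\<close> near each net point that has one keeps the countable set inside \<open>A\<close>,
  as needed for infima over \<open>X\<close>.\<close>

lemma Rd_separable:
  assumes A: "A \<subseteq> Rd d"
  shows "\<exists>Q. countable Q \<and> Q \<subseteq> A \<and> (\<forall>x\<in>A. \<forall>e>0. \<exists>y\<in>Q. dist x y < e)"
proof -
  let ?C = "\<lambda>m. {x \<in> Rd d. \<forall>i. \<bar>Poly_Mapping.lookup x i\<bar> \<le> real m}"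
  define k where "k m n = (SOME k. finite k \<and> ?C m \<subseteq> (\<Union>x\<in>k. ball x (1 / real (Suc n))))" for m n
  have k: "finite (k m n) \<and> ?C m \<subseteq> (\<Union>x\<in>k m n. ball x (1 / real (Suc n)))" for m n
  proof -
    have "\<forall>e>0. \<exists>k. finite k \<and> ?C m \<subseteq> (\<Union>x\<in>k. ball x e)"
      using compact_cube[of d "real m"] unfolding compact_eq_totally_bounded by (rule conjunct2)
    then have "\<exists>k. finite k \<and> ?C m \<subseteq> (\<Union>x\<in>k. ball x (1 / real (Suc n)))"
      by (elim allE[of _ "1 / real (Suc n)"]) simp
    then show ?thesis unfolding k_def by (rule someI_ex)
  qed
  let ?I = "{(c, n). c \<in> (\<Union>m. k m n) \<and> A \<inter> ball c (1 / real (Suc n)) \<noteq> {}}"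
  define pick where "pick = (\<lambda>(c, n). SOME y. y \<in> A \<inter> ball c (1 / real (Suc n)))"
  have pick: "pick (c, n) \<in> A \<inter> ball c (1 / real (Suc n))" if "(c, n) \<in> ?I" for c n
  proof -
    have "\<exists>y. y \<in> A \<inter> ball c (1 / real (Suc n))" using that by blast
    from someI_ex[OF this] show ?thesis by (simp add: pick_def)
  qed
  have "countable ((\<Union>m n. k m n) \<times> (UNIV :: nat set))"
    by (intro countable_SIGMA countable_UN countable_finite k[THEN conjunct1] countableI_type)
  then have "countable ?I"
    by (rule countable_subset[rotated]) blast
  then have "countable (pick ` ?I)" by simp
  moreover have "pick ` ?I \<subseteq> A" using pick by blast
  moreover have "\<exists>y\<in>pick ` ?I. dist x y < e" if x: "x \<in> A" and e: "0 < e" for x e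
  proof -
    have "0 < e / 2" using e by simp
    then obtain n where n: "1 / real (Suc n) < e / 2" by (rule nat_approx_posE)
    obtain m where m: "norm x \<le> real m" using real_arch_simple by blast
    have "\<bar>Poly_Mapping.lookup x i\<bar> \<le> real m" for i
      using abs_lookup_le_norm m by (rule order_trans)
    then have "x \<in> ?C m" using x A by blast
    then obtain c where c: "c \<in> k m n" "x \<in> ball c (1 / real (Suc n))"
      using k[THEN conjunct2, of m n] by blast
    with x have I: "(c, n) \<in> ?I" by (simp only: mem_Collect_eq prod.case) blast
    have "dist c (pick (c, n)) < 1 / real (Suc n)" using pick[OF I] by simp
    moreover have "dist c x < 1 / real (Suc n)" using c(2) by simp
    moreover have "dist x (pick (c, n)) \<le> dist c x + dist c (pick (c, n))"
      using dist_triangle[of x "pick (c, n)" c] by (simp add: dist_commute)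
    ultimately have "dist x (pick (c, n)) < e" using n by linarith
    then show ?thesis using imageI[OF I, of pick] by (rule bexI)
  qed
  ultimately show ?thesis by (intro exI[of _ "pick ` ?I"] conjI ballI allI impI)
qed

section \<open>Norms and dual balls\<close>

locale Rd_norm =
  fixes d :: nat and N :: "vec \<Rightarrow> real"
  assumes norm: "norm_on (Rd d) N"
begin

lemma N_0 [simp]: "x \<in> Rd d \<Longrightarrow> N x = 0 \<longleftrightarrow> x = 0"
  and N_scale: "x \<in> Rd d \<Longrightarrow> N (a *\<^sub>R x) = \<bar>a\<bar> * N x"
  and N_triangle: "x \<in> Rd d \<Longrightarrow> y \<in> Rd d \<Longrightarrow> N (x + y) \<le> N x + N y"
  using norm by (auto simp: norm_on_def)

lemma N_zero [simp]: "N 0 = 0"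
  by (subst N_0) auto

lemma Rd_closed [simp]:
  "x \<in> Rd d \<Longrightarrow> a *\<^sub>R x \<in> Rd d" "x \<in> Rd d \<Longrightarrow> y \<in> Rd d \<Longrightarrow> x + y \<in> Rd d"
  "x \<in> Rd d \<Longrightarrow> y \<in> Rd d \<Longrightarrow> x - y \<in> Rd d" "x \<in> Rd d \<Longrightarrow> - x \<in> Rd d"
  using subspace_Rd by (auto simp: subspace_scale subspace_add subspace_diff subspace_neg)

lemma N_minus: "x \<in> Rd d \<Longrightarrow> N (- x) = N x"
  using N_scale[of x "- 1"] by simp

lemma N_nonneg: "x \<in> Rd d \<Longrightarrow> 0 \<le> N x"
  using N_triangle[of x "- x"] N_minus[of x] by simp

lemma N_le_norm: "\<exists>C\<ge>0. \<forall>x\<in>Rd d. N x \<le> C * norm x"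
proof (intro exI conjI ballI)
  let ?e = "\<lambda>i. Poly_Mapping.single i (1::real)"
  have e: "?e i \<in> Rd d" if "i < d" for i
    using that by (simp add: Rd_def)
  show "0 \<le> (\<Sum>i<d. N (?e i))" using e N_nonneg by (intro sum_nonneg) simp
  fix x assume "x \<in> Rd d"
  have sum: "(\<Sum>i\<in>I. Poly_Mapping.lookup x i *\<^sub>R ?e i) \<in> Rd d \<and>
      N (\<Sum>i\<in>I. Poly_Mapping.lookup x i *\<^sub>R ?e i) \<le> (\<Sum>i\<in>I. norm x * N (?e i))"
    if "finite I" "I \<subseteq> {..<d}" for I
    using that
  proof (induction I)
    case (insert i I)
    have i: "?e i \<in> Rd d" using e insert.prems by simp
    have "N (Poly_Mapping.lookup x i *\<^sub>R ?e i) \<le> norm x * N (?e i)"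
      unfolding N_scale[OF i] by (intro mult_right_mono abs_lookup_le_norm N_nonneg i)
    then show ?case
      using insert i N_triangle[of "Poly_Mapping.lookup x i *\<^sub>R ?e i" "\<Sum>i\<in>I. Poly_Mapping.lookup x i *\<^sub>R ?e i"]
      by auto
  qed auto
  then show "N x \<le> (\<Sum>i<d. N (?e i)) * norm x"
    using sum[of "{..<d}"] Rd_expand[OF \<open>x \<in> Rd d\<close>]
    by (simp add: sum_distrib_left mult.commute)
qed

text \<open>\<open>N\<close> is Lipschitz for the ambient norm and attains a positive minimum on the
  compact ambient unit sphere of \<open>Rd d\<close>; the sphere is empty exactly in dimension
  0.\<close>

lemma N_ge_norm: "\<exists>c>0. \<forall>x\<in>Rd d. c * norm x \<le> N x"
proof -
  let ?S = "{x \<in> Rd d. norm x = 1}"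
  obtain C where C: "0 \<le> C" "\<And>x. x \<in> Rd d \<Longrightarrow> N x \<le> C * norm x" using N_le_norm by blast
  have cont: "continuous_on (Rd d) N"
  proof (rule lipschitz_on_continuous_on[of C], rule lipschitz_onI)
    fix x y assume xy: "x \<in> Rd d" "y \<in> Rd d"
    have "N x \<le> N y + N (x - y)" "N y \<le> N x + N (x - y)"
      using N_triangle[of y "x - y"] N_triangle[of x "y - x"] N_minus[of "x - y"] xy by auto
    then show "dist (N x) (N y) \<le> C * dist x y"
      using C(2)[of "x - y"] xy by (auto simp: dist_real_def dist_norm)
  qed (rule C)
  have "?S = {x \<in> Rd d. \<forall>i. \<bar>Poly_Mapping.lookup x i\<bar> \<le> 1} \<inter> {x. norm x = 1}"
    by (auto intro: order_trans[OF abs_lookup_le_norm])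
  then have "compact ?S"
    by (simp add: compact_Int_closed compact_cube closed_Collect_eq continuous_intros)
  show ?thesis
  proof (cases "?S = {}")
    case True
    have "x = 0" if x: "x \<in> Rd d" for x
    proof (rule ccontr)
      assume "x \<noteq> 0"
      then have "inverse (norm x) *\<^sub>R x \<in> ?S" using x by simp
      with True show False by blast
    qed
    then show ?thesis by (intro exI[of _ 1]) fastforce
  next
    case False
    then obtain u where u: "u \<in> ?S" "\<And>x. x \<in> ?S \<Longrightarrow> N u \<le> N x"
      using continuous_attains_inf[OF \<open>compact ?S\<close> False continuous_on_subset[OF cont]] by blast
    have "0 < N u" using u(1) N_nonneg[of u] N_0[of u] by (force simp: less_le)
    moreover have "N u * norm x \<le> N x" if x: "x \<in> Rd d" for x
    proof (cases "x = 0")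
      case False
      then have "inverse (norm x) *\<^sub>R x \<in> ?S" using x by simp
      from u(2)[OF this] have "N u \<le> inverse (norm x) * N x" using x by (simp add: N_scale)
      then show ?thesis using False by (simp add: field_simps)
    qed simp
    ultimately show ?thesis by blast
  qed
qed

text \<open>The dual unit ball as an intersection of pointwise conditions rather than through a
  supremum; in this form it is visibly closed, which makes membership of a random vector an
  event.\<close>

definition dual_ball :: "vec set" where
  "dual_ball = {z \<in> Rd d. \<forall>x\<in>Rd d. dotp z x \<le> N x}"

lemma dual_ball_Rd: "z \<in> dual_ball \<Longrightarrow> z \<in> Rd d"
  by (simp add: dual_ball_def)

lemma abs_dotp_le: "z \<in> dual_ball \<Longrightarrow> x \<in> Rd d \<Longrightarrow> \<bar>dotp z x\<bar> \<le> N x"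
  using N_minus[of x] Rd_closed(4)[of x] unfolding dual_ball_def abs_le_iff
  by (metis (no_types, lifting) dotp_simps(3) mem_Collect_eq)

lemma zero_in_dual_ball: "0 \<in> dual_ball"
  by (simp add: dual_ball_def N_nonneg)

text \<open>A real supremum bounds its members only if the set is bounded above; this follows from
  comparing \<open>N\<close> with the ambient norm. Homogeneity then extends the bound from the unit
  ball.\<close>

lemma dual_ballI:
  assumes z: "z \<in> Rd d" and le: "dual_norm (Rd d) N z \<le> 1"
  shows "z \<in> dual_ball"
  unfolding dual_ball_def
proof (intro CollectI conjI ballI z)
  fix x assume x: "x \<in> Rd d"
  obtain K where K: "\<And>x. norm (dotp z x) \<le> norm x * K" "0 < K"
    using bounded_linear.pos_bounded[OF bounded_linear_dotp] by blast
  obtain c where c: "0 < c" "\<And>x. x \<in> Rd d \<Longrightarrow> c * norm x \<le> N x" using N_ge_norm by blast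
  have "dotp z y \<le> K / c" if "y \<in> Rd d" "N y \<le> 1" for y
  proof -
    have "norm y \<le> 1 / c" using c(2)[OF that(1)] that(2) c(1) by (simp add: field_simps)
    then have "norm y * K \<le> 1 / c * K" using K(2) by (intro mult_right_mono) auto
    then show ?thesis using K(1)[of y] by simp
  qed
  then have bdd: "bdd_above (dotp z ` {x \<in> Rd d. N x \<le> 1})" by (intro bdd_aboveI) auto
  have unit: "dotp z y \<le> 1" if "y \<in> Rd d" "N y \<le> 1" for y
    using cSUP_upper[OF _ bdd, of y] that le by (simp add: dual_norm_def)
  show "dotp z x \<le> N x"
  proof (cases "x = 0")
    case False
    then have pos: "0 < N x" using N_0[OF x] N_nonneg[OF x] by linarith
    then have "dotp z (inverse (N x) *\<^sub>R x) \<le> 1" using x by (intro unit) (simp_all add: N_scale field_simps)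
    then show ?thesis using pos by (simp add: field_simps)
  qed (use N_nonneg[OF x] in simp)
qed

text \<open>\<open>dotp\<close> sums over the support of its first argument, which varies. On
  \<open>Rd d\<close> the sum may run over fixed indices and is then continuous in
  \<open>z\<close>.\<close>

lemma closed_dual_ball: "closed dual_ball"
proof -
  have "dual_ball = Rd d \<inter> (\<Inter>x\<in>Rd d. {z. (\<Sum>i<d. Poly_Mapping.lookup z i * Poly_Mapping.lookup x i) \<le> N x})"
    by (auto simp: dual_ball_def dotp_Rd)
  also have "closed \<dots>"
    by (intro closed_Int closed_Rd closed_INT ballI closed_Collect_le continuous_intros)
  finally show ?thesis .
qed

end

section \<open>Derivatives within a subspace\<close>

text \<open>Restricting to the line through \<open>x\<close> in direction \<open>v\<close>, which
  stays in \<open>V\<close>, reduces the claim to uniqueness of derivatives of functions of one real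
  variable.\<close>

lemma has_derivative_within_subspace_unique:
  assumes f': "(f has_derivative f') (at x within V)" and f'': "(f has_derivative f'') (at x within V)"
    and V: "subspace V" "x \<in> V" "v \<in> V"
  shows "f' v = f'' v"
proof -
  let ?l = "\<lambda>s::real. x + s *\<^sub>R v"
  have l: "(?l has_derivative (\<lambda>s. s *\<^sub>R v)) (at 0)"
    by (auto intro!: derivative_eq_intros)
  have V': "range ?l \<subseteq> V" using V by (auto simp: subspace_add subspace_scale)
  have "((\<lambda>s. f (?l s)) has_derivative (\<lambda>s. g (s *\<^sub>R v))) (at 0)"
    if "(f has_derivative g) (at x within V)" for g
    by (rule has_derivative_in_compose[OF l]) (use has_derivative_subset[OF that V'] in simp)
  from has_derivative_unique[OF this[OF f'] this[OF f'']]
  show ?thesis by (auto dest: fun_cong[of _ _ 1])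
qed

text \<open>\<open>frechet_derivative\<close> selects an arbitrary derivative within
  \<open>V\<close>; on directions of \<open>V\<close> uniqueness forces it to be the next entry of
  the jet.\<close>

lemma nabla_jet:
  assumes J: "jet n J" and V: "subspace V" and f: "\<And>x. x \<in> V \<Longrightarrow> f x = J [] x"
    and "set vs \<subseteq> V" "length vs \<le> n" "x \<in> V"
  shows "nabla V f vs x = J vs x"
  using assms(4-)
proof (induction vs arbitrary: x)
  case (Cons v vs)
  have "(nabla V f vs has_derivative (\<lambda>v. J (v # vs) x)) (at x within V)"
    by (rule has_derivative_transform[OF _ _ has_derivative_at_withinI[OF jetD[OF J]]])
      (use Cons in auto)
  note J' = this
  then have
    "(nabla V f vs has_derivative frechet_derivative (nabla V f vs) (at x within V)) (at x within V)"
    using frechet_derivative_works differentiableI by blast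
  from has_derivative_within_subspace_unique[OF this J' V, of v] Cons.prems
  show ?case by simp
qed (use f in simp)

lemma times_differentiable_on_jet:
  assumes J: "jet n J" and V: "subspace V" and f: "\<And>x. x \<in> V \<Longrightarrow> f x = J [] x"
  shows "times_differentiable_on V n f"
  unfolding times_differentiable_on_def differentiable_on_def
proof (intro allI impI ballI)
  fix vs x assume vs: "set vs \<subseteq> V \<and> length vs < n" and x: "x \<in> V"
  have "(nabla V f vs has_derivative (\<lambda>v. J (v # vs) x)) (at x within V)"
    by (rule has_derivative_transform[OF _ _ has_derivative_at_withinI[OF jetD[OF J]]])
      (use nabla_jet[OF J V f] vs x in auto)
  then show "nabla V f vs differentiable at x within V" by (rule differentiableI)
qed


section \<open>The hard functions\<close>

text \<open>
  The vectors after \<open>z t\<close> are replaced by \<open>z t\<close>; sequences are indexed from 0, the vectors from 1.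
\<close>
definition trunc :: "(nat \<Rightarrow> 'a) \<Rightarrow> nat \<Rightarrow> nat \<Rightarrow> 'a" where
  "trunc z t i = z (min (Suc i) t)"

text \<open>The bound on \<open>G\<close> provides two margins: \<open>G / 2\<close> exceeds the
  threshold \<open>2 * w * l\<close> of \<open>smax_local\<close>, and \<open>G / 4\<close> exceeds
  the excess \<open>w * l\<close> of \<open>smax_le\<close>, both for
  \<open>w = Suc q\<close>.\<close>

locale hard_family = Rd_norm d N for d and N +
  fixes q :: nat and D :: "nat \<Rightarrow> real \<Rightarrow> real" and A \<mu> G :: real and l :: nat
  assumes ramp_jet: "ramp_jet (Suc q) D"
    and A_pos: "0 < A" and \<mu>_pos: "0 < \<mu>"
    and G_large: "4 * real (Suc q) * real l < G"
begin

sublocale ramp "D 0" "real (Suc q)"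
  using ramp_jet by unfold_locales (auto simp: ramp_jet_def)

definition leaf :: "(nat \<Rightarrow> vec) \<Rightarrow> nat \<Rightarrow> vec list \<Rightarrow> vec \<Rightarrow> real" where
  "leaf \<zeta> i = affine_jet (dotp (\<zeta> i)) (- (G * real i))"

definition hard_jet :: "(nat \<Rightarrow> vec) \<Rightarrow> vec list \<Rightarrow> vec \<Rightarrow> real" where
  "hard_jet \<zeta> vs x = A * (1 / \<mu>) ^ length vs * smax_jet D l (leaf \<zeta>) 0 vs ((1 / \<mu>) *\<^sub>R x)"

definition hard :: "(nat \<Rightarrow> vec) \<Rightarrow> vec \<Rightarrow> real" where
  "hard \<zeta> x = A * smax l (\<lambda>i. dotp (\<zeta> i) x / \<mu> - G * real i) 0"

definition hard_on :: "(nat \<Rightarrow> vec) \<Rightarrow> vec \<Rightarrow> real" where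
  "hard_on \<zeta> = restrict (hard \<zeta>) (Rd d)"

lemma hard_on_eq [simp]: "x \<in> Rd d \<Longrightarrow> hard_on \<zeta> x = hard \<zeta> x"
  by (simp add: hard_on_def)

lemma G_pos: "0 < G"
  using G_large by (smt (verit) mult_nonneg_nonneg of_nat_0_le_iff)

lemma hard_jet_Nil: "hard_jet \<zeta> [] = hard \<zeta>"
  by (rule ext) (simp add: hard_jet_def hard_def smax_jet_Nil leaf_def affine_jet_def)

lemma jet_hard: "jet (Suc q) (hard_jet \<zeta>)"
proof -
  have "jet (Suc q) (smax_jet D l (leaf \<zeta>) 0)"
    using ramp_jet unfolding leaf_def[abs_def]
    by (intro jet_smax_jet jet_affine bounded_linear_dotp) (auto simp: ramp_jet_def)
  then show ?thesis
    unfolding hard_jet_def[abs_def] by (rule jet_rescale)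
qed

lemma convex_hard: "convex_on (Rd d) (hard_on \<zeta>)"
proof -
  have "convex_on (Rd d) (\<lambda>x. dotp (\<zeta> i) x / \<mu> - G * real i)" for i
    by (rule convex_onI)
      (auto simp: subspace_imp_convex[OF subspace_Rd] add_divide_distrib diff_divide_distrib algebra_simps)
  then have "convex_on (Rd d) (\<lambda>x. smax l (\<lambda>i. dotp (\<zeta> i) x / \<mu> - G * real i) 0)"
    by (rule convex_on_smax)
  then have "convex_on (Rd d) (hard \<zeta>)"
    unfolding hard_def[abs_def] using A_pos by (intro convex_on_cmul) auto
  then show ?thesis
    by (simp add: convex_on_def subspace_add[OF subspace_Rd] subspace_scale[OF subspace_Rd])
qed

lemma continuous_on_hard: "continuous_on S (hard \<zeta>)"
  using jetD[OF jet_hard, of "[]"] has_derivative_continuous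
  by (intro continuous_at_imp_continuous_on) (fastforce simp: hard_jet_Nil)

text \<open>At unscaled distance at most 1 the bound of order \<open>q + 1\<close> gives a Lipschitz
  estimate, and a number in \<open>[0, 1]\<close> is at most its power \<nu>. At larger distance the
  bound of order \<open>q\<close> gives \<open>2 * B\<close>, and the power is at least 1. Scaling
  contributes \<mu> to the power \<open>- q\<close> from the derivatives and \<open>- \<nu>\<close>
  from the distance.\<close>

lemma holder_hard:
  assumes \<zeta>: "\<And>i. \<zeta> i \<in> dual_ball" and \<nu>: "0 < \<nu>" "\<nu> \<le> 1"
    and B: "\<And>vs x. vs \<noteq> [] \<Longrightarrow> length vs \<le> Suc q \<Longrightarrow> set vs \<subseteq> {v \<in> Rd d. N v \<le> 1} \<Longrightarrow>
      \<bar>smax_jet D l (leaf \<zeta>) 0 vs x\<bar> \<le> B"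
    and L: "A * (2 * B) = L * \<mu> powr (real q + \<nu>)" and q: "1 \<le> q"
  shows "holder_derivative (Rd d) N q L \<nu> (hard_on \<zeta>)"
proof -
  let ?U = "{v \<in> Rd d. N v \<le> 1}" and ?J = "smax_jet D l (leaf \<zeta>) 0" and ?V = "Rd d"
  have f: "hard_on \<zeta> x = hard_jet \<zeta> [] x" if "x \<in> ?V" for x
    using that by (simp add: hard_jet_Nil)
  have J: "jet (Suc q) ?J"
    using ramp_jet unfolding leaf_def[abs_def]
    by (intro jet_smax_jet jet_affine bounded_linear_dotp) (auto simp: ramp_jet_def)
  have B0: "0 \<le> B"
    using B[of "[0]" 0] by fastforce
  have diff: "\<bar>?J (replicate q v) x - ?J (replicate q v) y\<bar> \<le> 2 * B * N (x - y) powr \<nu>"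
    if v: "v \<in> ?U" and x: "x \<in> ?V" and y: "y \<in> ?V" for v x y
  proof (cases "N (x - y) \<le> 1")
    case True
    let ?t = "N (x - y)"
    show ?thesis
    proof (cases "x = y")
      case False
      then have t: "0 < ?t" using N_0[of "x - y"] N_nonneg[of "x - y"] x y by (simp add: less_le)
      let ?w = "inverse ?t *\<^sub>R (x - y)"
      have w: "?w \<in> ?U"
        using t x y N_scale[of "x - y" "inverse ?t"] False by simp
      have "\<bar>?J (replicate q v) (y + ?t *\<^sub>R ?w) - ?J (replicate q v) y\<bar> \<le> B * ?t"
      proof (rule jet_mean_value[OF J])
        show "\<bar>?J (?w # replicate q v) u\<bar> \<le> B" for u
          using v w by (intro B) auto
      qed (use t in auto)
      moreover have "y + ?t *\<^sub>R ?w = x" using t by simp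
      moreover have "?t \<le> ?t powr \<nu>"
        using powr_mono'[of \<nu> 1 ?t] t True \<nu> by simp
      then have "B * ?t \<le> 2 * B * ?t powr \<nu>"
        using B0 t by (intro mult_mono) auto
      ultimately show ?thesis by simp
    qed (use B0 in simp)
  next
    case False
    have "\<bar>?J (replicate q v) u\<bar> \<le> B" for u
      using v q by (intro B) auto
    from this[of x] this[of y] have "\<bar>?J (replicate q v) x - ?J (replicate q v) y\<bar> \<le> 2 * B * 1"
      by linarith
    also have "\<dots> \<le> 2 * B * N (x - y) powr \<nu>"
      using False \<nu> B0 by (intro mult_left_mono ge_one_powr_ge_zero) auto
    finally show ?thesis .
  qed
  have "form_norm ?V N q (\<lambda>vs. nabla ?V (hard_on \<zeta>) vs x - nabla ?V (hard_on \<zeta>) vs y)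
      \<le> L * N (x - y) powr \<nu>" if x: "x \<in> ?V" and y: "y \<in> ?V" for x y
    unfolding form_norm_def
  proof (rule cSUP_least)
    show "?U \<noteq> {}" by (auto intro!: exI[of _ 0])
    fix v assume v: "v \<in> ?U"
    let ?vs = "replicate q v" and ?s = "\<lambda>x. (1 / \<mu>) *\<^sub>R x"
    have "nabla ?V (hard_on \<zeta>) ?vs x = hard_jet \<zeta> ?vs x" if "x \<in> ?V" for x
      using v that by (intro nabla_jet[OF jet_hard subspace_Rd f]) auto
    then have "\<bar>nabla ?V (hard_on \<zeta>) ?vs x - nabla ?V (hard_on \<zeta>) ?vs y\<bar> =
        \<bar>A * (1 / \<mu>) ^ q * (?J ?vs (?s x) - ?J ?vs (?s y))\<bar>"
      using x y by (simp add: hard_jet_def algebra_simps)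
    also have "\<dots> = A * (1 / \<mu>) ^ q * \<bar>?J ?vs (?s x) - ?J ?vs (?s y)\<bar>"
      using A_pos \<mu>_pos by (simp add: abs_mult)
    also have "\<dots> \<le> A * (1 / \<mu>) ^ q * (2 * B * N (?s x - ?s y) powr \<nu>)"
      using A_pos \<mu>_pos v x y by (intro mult_left_mono diff) auto
    also have "N (?s x - ?s y) = N (x - y) / \<mu>"
      using N_scale[of "x - y" "1 / \<mu>"] x y \<mu>_pos by (simp add: scaleR_diff_right)
    also have "A * (1 / \<mu>) ^ q * (2 * B * (N (x - y) / \<mu>) powr \<nu>) =
        A * (2 * B) / \<mu> powr (real q + \<nu>) * N (x - y) powr \<nu>"
      using N_nonneg[of "x - y"] x y \<mu>_pos
      by (simp add: powr_divide powr_add powr_realpow power_one_over field_simps)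
    also have "\<dots> = L * N (x - y) powr \<nu>"
      using \<mu>_pos by (simp add: L)
    finally show "\<bar>nabla ?V (hard_on \<zeta>) ?vs x - nabla ?V (hard_on \<zeta>) ?vs y\<bar> \<le> L * N (x - y) powr \<nu>" .
  qed
  moreover have "times_differentiable_on ?V (Suc q) (hard_on \<zeta>)"
    by (rule times_differentiable_on_jet[OF jet_hard subspace_Rd f])
  then have "times_differentiable_on ?V q (hard_on \<zeta>)"
    by (auto simp: times_differentiable_on_def)
  ultimately show ?thesis
    by (simp add: holder_derivative_def)
qed

lemma leaf_le_1:
  assumes "\<And>i. \<zeta> i \<in> dual_ball" "B \<noteq> []" "set B \<subseteq> {v \<in> Rd d. N v \<le> 1}"
  shows "\<bar>leaf \<zeta> i B x\<bar> \<le> 1"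
proof (cases B)
  case (Cons v vs)
  then have "\<bar>dotp (\<zeta> i) v\<bar> \<le> 1" using abs_dotp_le[OF assms(1), of v i] assms(3) by auto
  then show ?thesis by (cases vs) (auto simp: leaf_def affine_jet_def Cons)
qed (use assms in simp)

text \<open>
  Where \<open>z t\<close> is not too negative and the later vectors are not too positive, the shifts \<open>G * i\<close>
  make the leaves beyond \<open>t\<close> irrelevant.
\<close>
lemma hard_trunc_eq:
  assumes t: "1 \<le> t" "t \<le> t'" "t' \<le> T" "T \<le> 2 ^ l"
    and low: "- (G * \<mu> / 4) < dotp (z t) x"
    and high: "\<And>i. t < i \<Longrightarrow> i \<le> T \<Longrightarrow> dotp (z i) x < G * \<mu> / 4"
  shows "hard (trunc z t) x = hard (trunc z t') x"
proof -
  let ?y = "\<lambda>t i. dotp (trunc z t i) x / \<mu> - G * real i"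
  let ?j = "t - 1"
  \<comment> \<open>Leaf \<open>t - 1\<close> carries \<open>z t\<close> in every truncation from
    \<open>t\<close> on, so it is the common dominant leaf.\<close>
  have yj: "?y s ?j = dotp (z t) x / \<mu> - G * (real t - 1)" if "t \<le> s" for s
    using t that by (simp add: trunc_def of_nat_diff min_def)
  have low': "- (G / 4) < dotp (z t) x / \<mu>"
    using low \<mu>_pos by (simp add: field_simps)
  \<comment> \<open>A later leaf that repeats \<open>z t\<close> is lower by at least a full shift
    \<open>G\<close>. One that carries a later vector gains at most \<open>G / 4\<close> from it and
    at most \<open>G / 4\<close> from \<open>z t\<close> being negative, so \<open>G / 2\<close> of
    the shift remains.\<close>
  have small: "?y s i \<le> ?y t ?j - G / 2" if s: "t \<le> s" "s \<le> T" and i: "t \<le> i" for s i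
  proof -
    have Gi: "G * real t \<le> G * real i" using i G_pos by simp
    consider "min (Suc i) s = t" | "t < min (Suc i) s" "min (Suc i) s \<le> T" using s i by linarith
    then show ?thesis
    proof cases
      case 1
      then have "?y s i = dotp (z t) x / \<mu> - G * real i" by (simp add: trunc_def)
      then show ?thesis unfolding yj[OF order_refl] right_diff_distrib using Gi G_pos by linarith
    next
      case 2
      then have "dotp (z (min (Suc i) s)) x / \<mu> < G / 4"
        using high[OF 2] \<mu>_pos by (simp add: field_simps)
      then show ?thesis unfolding yj[OF order_refl] using Gi low'
        unfolding trunc_def right_diff_distrib by linarith
    qed
  qed
  have "smax l (?y t) 0 = smax l (?y t') 0"
  proof (rule smax_local[where j = ?j and M = "?y t ?j - G / 2"])
    show "?j < 2 ^ l" using t by linarith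
    show "?y t ?j = ?y t' ?j" using yj[OF order_refl] yj[OF t(2)] by (rule trans[OF _ sym])
    show "?y t ?j - G / 2 + 2 * real (Suc q) * real l < ?y t ?j"
      using G_large by (simp add: algebra_simps)
    show "?y t i = ?y t' i \<or> ?y t i \<le> ?y t ?j - G / 2 \<and> ?y t' i \<le> ?y t ?j - G / 2" for i
    proof (cases "t \<le> i")
      case True
      then show ?thesis using small[of t i] small[of t' i] t by auto
    next
      case False
      then show ?thesis using t by (simp add: trunc_def min_def)
    qed
  qed
  then show ?thesis by (simp add: hard_def)
qed

text \<open>A single leaf suffices: leaf \<open>t - 1\<close> has shift at most
  \<open>G * (T - 1)\<close> and inner product above \<open>- G / 4\<close> after scaling, together
  \<open>- G * (T - 3 / 4)\<close>.\<close>

lemma hard_ge: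
  assumes "1 \<le> t" "t \<le> T" "T \<le> 2 ^ l" "- (G * \<mu> / 4) < dotp (z t) x"
  shows "- (A * G * (real T - 3 / 4)) \<le> hard (trunc z T) x"
proof -
  have "- (G / 4) - G * (real T - 1) \<le> dotp (z t) x / \<mu> - G * (real t - 1)"
  proof -
    have "- (G / 4) < dotp (z t) x / \<mu>" using assms \<mu>_pos by (simp add: field_simps)
    moreover have "G * real t \<le> G * real T" using assms G_pos by simp
    ultimately show ?thesis by (simp add: algebra_simps)
  qed
  also have "\<dots> \<le> smax l (\<lambda>i. dotp (trunc z T i) x / \<mu> - G * real i) 0"
    using smax_ge[of "t - 1" l "\<lambda>i. dotp (trunc z T i) x / \<mu> - G * real i" 0] assms
    by (simp add: trunc_def of_nat_diff min_def)
  finally have "A * (- (G / 4) - G * (real T - 1)) \<le> hard (trunc z T) x"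
    unfolding hard_def using A_pos by (intro mult_left_mono) auto
  then show ?thesis by (simp add: algebra_simps)
qed

text \<open>The shifts only lower the leaves, and the excess of the soft maximum is below
  \<open>G / 4\<close>. The hypothesis asks for half of the descent \<Theta>, since
  \<open>4 * T * G * \<mu>\<close> will be \<Theta>.\<close>

lemma hard_le:
  assumes "1 \<le> T" "\<And>i. 1 \<le> i \<Longrightarrow> i \<le> T \<Longrightarrow> dotp (z i) x \<le> - (2 * real T * G * \<mu>)"
  shows "hard (trunc z T) x \<le> - (A * G * (2 * real T - 1 / 4))"
proof -
  have "dotp (trunc z T i) x / \<mu> - G * real i \<le> - (2 * real T * G)" for i
  proof -
    have "dotp (trunc z T i) x / \<mu> \<le> - (2 * real T * G * \<mu>) / \<mu>"
      using assms \<mu>_pos by (intro divide_right_mono) (auto simp: trunc_def)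
    moreover have "0 \<le> G * real i" using G_pos by simp
    ultimately show ?thesis using \<mu>_pos by simp
  qed
  then have "smax l (\<lambda>i. dotp (trunc z T i) x / \<mu> - G * real i) 0
      \<le> - (2 * real T * G) + real (Suc q) * real l"
    by (intro smax_le) simp
  also have "\<dots> \<le> - (G * (2 * real T - 1 / 4))"
    using G_large by (simp add: algebra_simps)
  finally have "hard (trunc z T) x \<le> A * - (G * (2 * real T - 1 / 4))"
    unfolding hard_def using A_pos by (intro mult_left_mono) auto
  then show ?thesis by (simp add: algebra_simps)
qed

lemma measurable_dotp_Rd:
  assumes "\<And>m. f m \<in> Rd d" and [measurable]: "f \<in> borel_measurable M" "g \<in> borel_measurable M"
  shows "(\<lambda>m. dotp (f m) (g m)) \<in> borel_measurable M"
proof -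
  have [measurable]: "(\<lambda>x::vec. Poly_Mapping.lookup x i) \<in> borel_measurable borel" for i
    by (intro borel_measurable_continuous_onI continuous_intros)
  show ?thesis unfolding dotp_Rd[OF assms(1)] by measurable
qed

lemma measurable_hard:
  assumes "\<And>i m. \<zeta> m i \<in> Rd d" "\<And>i. (\<lambda>m. \<zeta> m i) \<in> borel_measurable M"
  shows "(\<lambda>m. hard (\<zeta> m) x) \<in> borel_measurable M"
proof -
  have [measurable]: "(\<lambda>m. dotp (\<zeta> m i) x) \<in> borel_measurable M" for i
    by (rule measurable_dotp_Rd[of "\<lambda>m. \<zeta> m i" M "\<lambda>_. x"]) (use assms in auto)
  show ?thesis unfolding hard_def by measurable
qed

end


section \<open>Interaction with an oracle\<close>

text \<open>Here \<open>ans t\<close> stands for the oracle of the function that knows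
  \<open>t\<close> vectors. If all functions knowing at least \<open>t\<close> vectors share the
  first \<open>t\<close> rounds, their next batch is the one computed with \<open>ans t\<close>, and
  the hypothesis equates the answers to it for all functions knowing one vector more.\<close>

lemma transcript_agree:
  assumes len: "\<And>h. length (a h) = K"
    and agree: "\<And>t t' k. 1 \<le> t \<Longrightarrow> t \<le> t' \<Longrightarrow> t' \<le> T \<Longrightarrow> 1 \<le> k \<Longrightarrow> k \<le> K \<Longrightarrow>
      ans t' (query a (ans (t - 1)) t k) = ans T (query a (ans (t - 1)) t k)"
  shows "t \<le> t' \<Longrightarrow> t' \<le> T \<Longrightarrow> transcript a (ans t') t = transcript a (ans T) t"
proof (induction t arbitrary: t')
  case (Suc t)
  let ?h = "transcript a (ans T) t"
  have h: "transcript a (ans s) t = ?h" if "t \<le> s" "s \<le> T" for s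
    using Suc.IH that by blast
  have "ans t' x = ans T x" if x: "x \<in> set (a ?h)" for x
  proof -
    obtain j where j: "j < K" "x = a ?h ! j" using x len by (auto simp: in_set_conv_nth)
    then have "x = query a (ans t) (Suc t) (Suc j)"
      using h[of t] Suc.prems by (simp add: query_def)
    then show ?thesis using agree[of "Suc t" t' "Suc j"] Suc.prems j by simp
  qed
  then have "map (ans t') (a ?h) = map (ans T) (a ?h)" by simp
  then show ?case using h[of t'] Suc.prems by (simp add: Let_def)
qed simp

lemma query_agree:
  assumes "\<And>h. length (a h) = K"
    and "\<And>t t' k. 1 \<le> t \<Longrightarrow> t \<le> t' \<Longrightarrow> t' \<le> T \<Longrightarrow> 1 \<le> k \<Longrightarrow> k \<le> K \<Longrightarrow>
      ans t' (query a (ans (t - 1)) t k) = ans T (query a (ans (t - 1)) t k)"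
    and "t \<le> T"
  shows "query a (ans T) t k = query a (ans (t - 1)) t k"
proof -
  have "transcript a (ans (t - 1)) (t - 1) = transcript a (ans T) (t - 1)"
  proof (rule transcript_agree[where K = K])
    show "t - 1 \<le> T" using assms(3) by simp
  qed (fact assms(1,2) order_refl)+
  then show ?thesis by (simp add: query_def)
qed

lemma query_in:
  assumes "\<And>h. length (a h) = K \<and> set (a h) \<subseteq> X" "1 \<le> k" "k \<le> K"
  shows "query a ans t k \<in> X"
proof -
  let ?h = "transcript a ans (t - 1)"
  have "a ?h ! (k - 1) \<in> set (a ?h)" using assms(1)[of ?h] assms(2,3) by (intro nth_mem) simp
  then show ?thesis using assms(1)[of ?h] by (auto simp: query_def)
qed

section \<open>Measurability\<close>

text \<open>Measurability of a Caratheodory function: the random point is approximated by the first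
  member of a countable dense sequence within \<open>1 / Suc n\<close>. Along such countably valued
  points evaluation is measurable, and continuity passes to the limit.\<close>

lemma measurable_eval_Rd:
  fixes F :: "'m \<Rightarrow> vec \<Rightarrow> real"
  assumes x [measurable]: "x \<in> borel_measurable M" and x_in: "\<And>m. m \<in> space M \<Longrightarrow> x m \<in> Rd d"
    and F: "\<And>y. y \<in> Rd d \<Longrightarrow> (\<lambda>m. F m y) \<in> borel_measurable M"
    and cont: "\<And>m. m \<in> space M \<Longrightarrow> continuous_on (Rd d) (F m)"
  shows "(\<lambda>m. F m (x m)) \<in> borel_measurable M"
proof -
  obtain Q where Q: "countable Q" "Q \<subseteq> Rd d" and dense: "\<forall>x\<in>Rd d. \<forall>e>0. \<exists>y\<in>Q. dist x y < e"
    using Rd_separable[OF order_refl, of d] by (rule exE) blast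
  have "\<exists>y\<in>Q. dist 0 y < 1"
    using dense by (simp del: dist_0_norm)
  then have Q_ne: "Q \<noteq> {}" by blast
  define e where "e = from_nat_into Q"
  have e: "e j \<in> Rd d" for j using from_nat_into[OF Q_ne, of j] Q(2) unfolding e_def by blast
  define idx where "idx n m = (LEAST j. dist (x m) (e j) < 1 / real (Suc n))" for n m
  have [measurable]: "(\<lambda>m. dist (x m) c) \<in> borel_measurable M" for c
    by (rule measurable_compose[OF x borel_measurable_continuous_onI]) (intro continuous_intros)
  have idx_meas: "idx n \<in> measurable M (count_space UNIV)" for n
    unfolding idx_def[abs_def] by measurable
  have idx: "dist (x m) (e (idx n m)) < 1 / real (Suc n)" if m: "m \<in> space M" for n m
  proof -
    have "\<exists>y\<in>Q. dist (x m) y < 1 / real (Suc n)"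
      by (rule dense[rule_format, OF x_in[OF m]]) simp
    then obtain y where y: "y \<in> Q" "dist (x m) y < 1 / real (Suc n)" by blast
    from from_nat_into_surj[OF Q(1) y(1)] obtain j where "e j = y"
      unfolding e_def by (rule exE)
    with y(2) have "dist (x m) (e j) < 1 / real (Suc n)" by simp
    from LeastI[of "\<lambda>j. dist (x m) (e j) < 1 / real (Suc n)", OF this]
    show ?thesis by (simp only: idx_def)
  qed
  have "(\<lambda>m. F m (e (idx n m))) \<in> borel_measurable M" for n
    by (rule measurable_compose_countable[where f = "\<lambda>j m. F m (e j)", OF F[OF e] idx_meas])
  moreover have "(\<lambda>n. F m (e (idx n m))) \<longlonglongrightarrow> F m (x m)" if m: "m \<in> space M" for m
  proof -
    have "(\<lambda>n. dist (e (idx n m)) (x m)) \<longlonglongrightarrow> 0"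
    proof (rule real_tendsto_sandwich)
      show "\<forall>\<^sub>F n in sequentially. 0 \<le> dist (e (idx n m)) (x m)" by simp
      show "\<forall>\<^sub>F n in sequentially. dist (e (idx n m)) (x m) \<le> 1 / real (Suc n)"
        using idx[OF m, THEN less_imp_le] by (intro always_eventually) (simp add: dist_commute)
      show "(\<lambda>n. 1 / real (Suc n)) \<longlonglongrightarrow> 0" by (rule LIMSEQ_Suc[OF lim_1_over_n])
    qed (rule tendsto_const)
    then have "(\<lambda>n. e (idx n m)) \<longlonglongrightarrow> x m" by (subst tendsto_dist_iff)
    then show ?thesis
      by (rule continuous_on_tendsto_compose[OF cont[OF m] _ x_in[OF m] always_eventually])
        (intro allI e)
  qed
  ultimately show ?thesis by (rule borel_measurable_LIMSEQ_real[rotated])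
qed

text \<open>Continuity reduces the infimum to a countable dense subset of \<open>X\<close>.\<close>

lemma measurable_INF_Rd:
  fixes F :: "'m \<Rightarrow> vec \<Rightarrow> real"
  assumes X: "X \<subseteq> Rd d"
    and F: "\<And>y. y \<in> X \<Longrightarrow> (\<lambda>m. F m y) \<in> borel_measurable M"
    and cont: "\<And>m. m \<in> space M \<Longrightarrow> continuous_on X (F m)"
  shows "(\<lambda>m. INF y\<in>X. ereal (F m y)) \<in> borel_measurable M"
proof -
  obtain Q where Q: "countable Q" "Q \<subseteq> X" and dense: "\<forall>x\<in>X. \<forall>e>0. \<exists>y\<in>Q. dist x y < e"
    using Rd_separable[OF X] by (rule exE) blast
  have "(INF y\<in>X. ereal (F m y)) = (INF y\<in>Q. ereal (F m y))" if m: "m \<in> space M" for m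
  proof (rule antisym)
    show "(INF y\<in>Q. ereal (F m y)) \<le> (INF y\<in>X. ereal (F m y))"
    proof (rule INF_greatest, rule ereal_le_epsilon2)
      fix x and \<epsilon> :: real assume x: "x \<in> X" and \<epsilon>: "0 < \<epsilon>"
      obtain r where r: "0 < r" "\<And>y. y \<in> X \<Longrightarrow> dist y x < r \<Longrightarrow> dist (F m y) (F m x) < \<epsilon>"
        using cont[OF m] x \<epsilon> unfolding continuous_on_iff by blast
      obtain y where y: "y \<in> Q" "dist x y < r" using dense x r(1) by blast
      then have "dist (F m y) (F m x) < \<epsilon>" using r(2)[of y] Q by (auto simp: dist_commute)
      then have "ereal (F m y) \<le> ereal (F m x) + ereal \<epsilon>" by (simp add: dist_real_def)
      then show "(INF y\<in>Q. ereal (F m y)) \<le> ereal (F m x) + ereal \<epsilon>"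
        using y(1) by (rule INF_lower2[rotated])
    qed
  qed (rule INF_superset_mono[OF Q(2)], simp)
  then have "(\<lambda>m. INF y\<in>X. ereal (F m y)) \<in> borel_measurable M \<longleftrightarrow>
      (\<lambda>m. INF y\<in>Q. ereal (F m y)) \<in> borel_measurable M"
    by (intro measurable_cong)
  also have "\<dots>"
    using F Q by (intro borel_measurable_INF) auto
  finally show ?thesis .
qed

section \<open>Deviation of queries that do not depend on the current vector\<close>

text \<open>For a fixed seed the prefix and \<open>z i\<close> are independent, so their joint law
  is a product. Fixing the prefix as well makes the query a deterministic point of \<open>X\<close>,
  where the tail bound applies; integrating over prefix and seed keeps it. The factor
  \<open>c\<close> serves both tails.\<close>

lemma prefix_deviation:
  fixes z :: "nat \<Rightarrow> 'w \<Rightarrow> vec" and g :: "'s \<times> (nat \<Rightarrow> vec) \<Rightarrow> vec"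
  assumes "prob_space M" "prob_space S"
    and indep: "prob_space.indep_vars M (\<lambda>_. borel) z {1..T}"
    and t: "1 \<le> t" "t \<le> i" "i \<le> T"
    and g [measurable]: "g \<in> borel_measurable (S \<Otimes>\<^sub>M (\<Pi>\<^sub>M j\<in>{1..<t}. borel))"
    and gX: "\<And>s y. s \<in> space S \<Longrightarrow> y \<in> space (\<Pi>\<^sub>M j\<in>{1..<t}. (borel :: vec measure)) \<Longrightarrow> g (s, y) \<in> X"
    and zR: "\<And>\<omega>. \<omega> \<in> space M \<Longrightarrow> z i \<omega> \<in> Rd d"
    and tail: "\<And>x. x \<in> X \<Longrightarrow> measure M {\<omega> \<in> space M. \<delta> \<le> c * dotp (z i \<omega>) x} \<le> p"
  defines "E \<equiv> {(s, \<omega>) \<in> space (S \<Otimes>\<^sub>M M). \<delta> \<le> c * dotp (z i \<omega>) (g (s, \<lambda>j\<in>{1..<t}. z j \<omega>))}"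
  shows "E \<in> sets (S \<Otimes>\<^sub>M M)" "measure (S \<Otimes>\<^sub>M M) E \<le> p"
proof -
  interpret M: prob_space M by fact
  interpret S: prob_space S by fact
  let ?P = "\<Pi>\<^sub>M j\<in>{1..<t}. (borel :: vec measure)"
  let ?y = "\<lambda>\<omega>. \<lambda>j\<in>{1..<t}. z j \<omega>"
  \<comment> \<open>A sum over fixed coordinates is jointly measurable in both vectors, unlike the
    support-dependent form of \<open>dotp\<close>, with which it agrees on the values of
    \<open>z i\<close>.\<close>
  define dt where "dt v x = (\<Sum>i<d. Poly_Mapping.lookup v i * Poly_Mapping.lookup x i)" for v x :: vec
  have [measurable]: "(\<lambda>x::vec. Poly_Mapping.lookup x i) \<in> borel_measurable borel" for i
    by (intro borel_measurable_continuous_onI continuous_intros)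
  have dt [measurable]: "(\<lambda>m. dt (f m) (h m)) \<in> borel_measurable N"
    if [measurable]: "f \<in> borel_measurable N" "h \<in> borel_measurable N" for f h and N :: "'x measure"
    unfolding dt_def by measurable
  have dt_eq: "dotp (z i \<omega>) x = dt (z i \<omega>) x" if "\<omega> \<in> space M" for \<omega> x
    using dotp_Rd[OF zR[OF that]] by (simp add: dt_def)
  \<comment> \<open>The single vector is viewed as a family over a singleton because independence is
    available for restrictions to disjoint index sets.\<close>
  let ?Q = "\<Pi>\<^sub>M j\<in>{i}. (borel :: vec measure)"
  let ?z = "\<lambda>\<omega>. \<lambda>j\<in>{i}. z j \<omega>"
  have ind: "M.indep_var ?P ?y ?Q ?z"
    using t by (intro M.indep_var_restrict[OF indep]) auto
  have rvs [measurable]: "?z \<in> measurable M ?Q" "?y \<in> measurable M ?P"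
    by (fact M.indep_var_rv2[OF ind] M.indep_var_rv1[OF ind])+
  have [measurable]: "z i \<in> borel_measurable M"
    using indep t by (auto simp: M.indep_vars_def)
  have E_eq: "E = {w \<in> space (S \<Otimes>\<^sub>M M). \<delta> \<le> c * dt (z i (snd w)) (g (fst w, ?y (snd w)))}"
    by (auto simp: E_def space_pair_measure dt_eq)
  show E: "E \<in> sets (S \<Otimes>\<^sub>M M)"
    unfolding E_eq by measurable
  have tail': "emeasure (distr M ?Q ?z) {v \<in> space ?Q. \<delta> \<le> c * dt (v i) x} \<le> ennreal p" if "x \<in> X" for x
  proof -
    have "emeasure (distr M ?Q ?z) {v \<in> space ?Q. \<delta> \<le> c * dt (v i) x} =
        emeasure M {\<omega> \<in> space M. \<delta> \<le> c * dotp (z i \<omega>) x}"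
      by (subst emeasure_distr) (auto simp: dt_eq space_PiM intro!: arg_cong[where f = "emeasure M"])
    then show ?thesis
      using tail[OF that] by (simp add: M.emeasure_eq_measure ennreal_leI)
  qed
  have section_le: "emeasure M (Pair s -` E) \<le> ennreal p" if s: "s \<in> space S" for s
  proof -
    let ?B = "{w \<in> space (?P \<Otimes>\<^sub>M ?Q). \<delta> \<le> c * dt (snd w i) (g (s, fst w))}"
    interpret Y: prob_space "distr M ?P ?y" by (rule M.prob_space_distr) (rule rvs)
    interpret Z: prob_space "distr M ?Q ?z" by (rule M.prob_space_distr) (rule rvs)
    have [measurable]: "(\<lambda>w. g (s, fst w)) \<in> borel_measurable (?P \<Otimes>\<^sub>M ?Q)"
      using s by measurable
    have B: "?B \<in> sets (?P \<Otimes>\<^sub>M ?Q)" by measurable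
    have "Pair s -` E = (\<lambda>\<omega>. (?y \<omega>, ?z \<omega>)) -` ?B \<inter> space M"
      using s by (auto simp: E_eq space_pair_measure space_PiM)
    then have "emeasure M (Pair s -` E) = emeasure (distr M (?P \<Otimes>\<^sub>M ?Q) (\<lambda>\<omega>. (?y \<omega>, ?z \<omega>))) ?B"
      by (simp only: emeasure_distr[OF measurable_Pair[OF rvs(2,1)] B])
    also have "\<dots> = emeasure (distr M ?P ?y \<Otimes>\<^sub>M distr M ?Q ?z) ?B"
      using ind unfolding M.indep_var_distribution_eq by simp
    also have "\<dots> = (\<integral>\<^sup>+y. emeasure (distr M ?Q ?z) (Pair y -` ?B) \<partial>distr M ?P ?y)"
      by (rule Z.emeasure_pair_measure_alt) (use B in simp)
    also have "\<dots> \<le> (\<integral>\<^sup>+y. ennreal p \<partial>distr M ?P ?y)"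
    proof (rule nn_integral_mono)
      fix y assume y: "y \<in> space (distr M ?P ?y)"
      then have "Pair y -` ?B = {v \<in> space ?Q. \<delta> \<le> c * dt (v i) (g (s, y))}"
        by (auto simp: space_pair_measure)
      then show "emeasure (distr M ?Q ?z) (Pair y -` ?B) \<le> ennreal p"
        using tail'[OF gX[OF s, of y]] y by simp
    qed
    also have "\<dots> = ennreal p"
      unfolding nn_integral_const Y.emeasure_space_1 by simp
    finally show ?thesis .
  qed
  have "emeasure (S \<Otimes>\<^sub>M M) E = (\<integral>\<^sup>+s. emeasure M (Pair s -` E) \<partial>S)"
    by (rule M.emeasure_pair_measure_alt[OF E])
  also have "\<dots> \<le> (\<integral>\<^sup>+s. ennreal p \<partial>S)"
    by (rule nn_integral_mono) (rule section_le)
  also have "\<dots> = ennreal p"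
    by (simp add: S.emeasure_space_1)
  finally have "emeasure (S \<Otimes>\<^sub>M M) E \<le> ennreal p" .
  \<comment> \<open>Returning from extended nonnegative reals requires \<open>0 \<le> p\<close>,
    which the tail bound at any point of \<open>X\<close> supplies.\<close>
  moreover obtain x where "x \<in> X"
    using gX S.not_empty by (metis all_not_in_conv space_PiM PiE_eq_empty_iff space_borel UNIV_not_empty)
  then have "0 \<le> p" using tail[of x] measure_nonneg order_trans by blast
  ultimately show "measure (S \<Otimes>\<^sub>M M) E \<le> p"
    unfolding measure_def by (intro enn2real_leI) auto
qed


section \<open>The distribution on the hard functions\<close>

lemma setcompr_pairs: "{g t k | t k. t \<in> A \<and> k \<in> B} = (\<lambda>(t, k). g t k) ` (A \<times> B)"
proof
  show "{g t k | t k. t \<in> A \<and> k \<in> B} \<subseteq> (\<lambda>(t, k). g t k) ` (A \<times> B)"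
    by (auto intro: rev_image_eqI)
next
  show "(\<lambda>(t, k). g t k) ` (A \<times> B) \<subseteq> {g t k | t k. t \<in> A \<and> k \<in> B}"
    by (simp add: image_subset_iff) blast
qed

text \<open>\<open>4 * T * G * \<mu>\<close> plays the role of \<Theta>, and \<open>p\<close> bounds
  a single deviation beyond \<open>G * \<mu> / 4\<close>; the last assumption is the union bound
  over rounds, queries of a round and vectors.\<close>

locale hard_distribution = hard_family d N q D A \<mu> G l + prob_space M
  for d N q D A \<mu> G l and M :: "'w measure" +
  fixes X :: "vec set" and T K :: nat and z :: "nat \<Rightarrow> 'w \<Rightarrow> vec" and \<eta> p :: real
  assumes X: "X \<subseteq> Rd d" "X \<noteq> {}"
    and T: "1 \<le> T" "T \<le> 2 ^ l" and K: "1 \<le> K"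
    and indep: "indep_vars (\<lambda>_. borel) z {1..T}"
    and z_Rd: "i \<in> {1..T} \<Longrightarrow> \<omega> \<in> space M \<Longrightarrow> z i \<omega> \<in> Rd d"
    and z_dual: "i \<in> {1..T} \<Longrightarrow> AE \<omega> in M. dual_norm (Rd d) N (z i \<omega>) \<le> 1"
    and descent: "1 - \<eta> \<le> measure M {\<omega> \<in> space M.
          (INF x\<in>X. ereal (MAX i\<in>{1..T}. dotp (z i \<omega>) x)) \<le> ereal (- (4 * real T * G * \<mu>))}"
    and \<eta>: "\<eta> < 1"
    and tail: "i \<in> {1..T} \<Longrightarrow> x \<in> X \<Longrightarrow> c \<in> {- 1, 1} \<Longrightarrow>
          measure M {\<omega> \<in> space M. G * \<mu> / 4 \<le> c * dotp (z i \<omega>) x} \<le> p"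
    and p: "real T * real T * real K * p \<le> \<eta>"
begin

text \<open>The dual norm is bounded only almost surely; replacing exceptional values by 0 keeps
  every function in the family. Index 0 is also sent to 0, so \<open>fam 0\<close> is one fixed
  function, which determines the first batch.\<close>

definition clamp :: "(nat \<Rightarrow> vec) \<Rightarrow> nat \<Rightarrow> vec" where
  "clamp y i = (if i \<in> {1..T} \<and> y i \<in> dual_ball then y i else 0)"

definition fam :: "nat \<Rightarrow> (nat \<Rightarrow> vec) \<Rightarrow> vec \<Rightarrow> real" where
  "fam t y = hard_on (trunc (clamp y) t)"

definition family :: "(vec \<Rightarrow> real) set" where
  "family = hard_on ` {\<zeta>. \<forall>i. \<zeta> i \<in> dual_ball}"

abbreviation family_algebra :: "(vec \<Rightarrow> real) measure" where
  "family_algebra \<equiv> restrict_space (\<Pi>\<^sub>M x\<in>Rd d. borel) family"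

definition F :: "'w \<Rightarrow> vec \<Rightarrow> real" where
  "F \<omega> = fam T (\<lambda>i. z i \<omega>)"

definition \<Delta> :: "(vec \<Rightarrow> real) measure" where
  "\<Delta> = distr M family_algebra F"

lemma clamp_dual_ball: "clamp y i \<in> dual_ball"
  by (simp add: clamp_def zero_in_dual_ball)

lemma fam_in_family: "fam t y \<in> family"
  by (auto simp: fam_def family_def trunc_def clamp_dual_ball)

lemma fam_cong: "(\<And>i. 1 \<le> i \<Longrightarrow> i \<le> t \<Longrightarrow> y i = y' i) \<Longrightarrow> fam t y = fam t y'"
  unfolding fam_def by (rule arg_cong[where f = hard_on]) (auto simp: trunc_def clamp_def fun_eq_iff)

lemma family_extensional: "family \<subseteq> extensional (Rd d)"
  by (auto simp: family_def hard_on_def)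

lemma space_family_algebra: "space family_algebra = family"
  using family_extensional by (auto simp: space_restrict_space space_PiM PiE_def)

lemma sets_\<Delta> [measurable_cong]: "sets \<Delta> = sets family_algebra"
  and space_\<Delta>: "space \<Delta> = family"
  by (simp_all add: \<Delta>_def space_family_algebra)

lemma measurable_fam:
  assumes f: "\<And>i. 1 \<le> i \<Longrightarrow> i \<le> t \<Longrightarrow> i \<le> T \<Longrightarrow> (\<lambda>m. f m i) \<in> borel_measurable N'"
  shows "(\<lambda>m. fam t (f m)) \<in> measurable N' family_algebra"
proof (rule measurable_restrict_space2)
  have clamp: "(\<lambda>m. trunc (clamp (f m)) t i) \<in> borel_measurable N'" for i
  proof (cases "min (Suc i) t \<in> {1..T}")
    case True
    then have [measurable]: "(\<lambda>m. f m (min (Suc i) t)) \<in> borel_measurable N'" by (intro f) auto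
    have [measurable]: "dual_ball \<in> sets borel" using closed_dual_ball by (rule borel_closed)
    show ?thesis unfolding trunc_def clamp_def using True by simp
  next
    case False
    then have "(\<lambda>m. trunc (clamp (f m)) t i) = (\<lambda>_. 0)"
      by (auto simp: trunc_def clamp_def)
    then show ?thesis by simp
  qed
  have "(\<lambda>m. hard (trunc (clamp (f m)) t) x) \<in> borel_measurable N'" for x
    by (intro measurable_hard clamp) (auto simp: trunc_def intro: dual_ball_Rd clamp_dual_ball)
  then show "(\<lambda>m. fam t (f m)) \<in> measurable N' (\<Pi>\<^sub>M x\<in>Rd d. borel)"
    unfolding fam_def hard_on_def by (rule measurable_restrict)
qed (use fam_in_family in auto)

lemma measurable_F: "F \<in> measurable M family_algebra"
  unfolding F_def[abs_def] using indep by (intro measurable_fam) (auto simp: indep_vars_def)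

lemma measurable_eval: "x \<in> Rd d \<Longrightarrow> (\<lambda>f. f x) \<in> borel_measurable family_algebra"
  by (intro measurable_restrict_space1 measurable_component_singleton)

lemma distribution_\<Delta>: "distribution_on (Rd d) family \<Delta>"
  using family_extensional sets_\<Delta> measurable_F
  by (simp add: distribution_on_def \<Delta>_def prob_space_distr)

lemma continuous_on_family: "f \<in> family \<Longrightarrow> continuous_on (Rd d) f"
  using continuous_on_hard by (auto simp: family_def hard_on_def cong: continuous_on_cong)

lemma prob_space_\<Delta>: "prob_space \<Delta>"
  using distribution_\<Delta> by (simp add: distribution_on_def)

text \<open>The deterministic core. Near a round \<open>t\<close> query of the truncated run all
  functions knowing at least \<open>t\<close> vectors coincide, so the oracle answers alike; the run
  on the full function therefore makes the very same queries, whose inner products are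
  controlled.\<close>

lemma gap_good:
  assumes orc: "local_oracle (Rd d) family orc"
    and a: "\<And>h. length (a h) = K \<and> set (a h) \<subseteq> X"
    and dual: "\<And>i. i \<in> {1..T} \<Longrightarrow> v i \<in> dual_ball"
    and min: "(INF x\<in>X. ereal (MAX i\<in>{1..T}. dotp (v i) x)) \<le> ereal (- (4 * real T * G * \<mu>))"
    and low: "\<And>t k. t \<in> {1..T} \<Longrightarrow> k \<in> {1..K} \<Longrightarrow>
      - (G * \<mu> / 4) < dotp (v t) (query a (orc (fam (t - 1) v)) t k)"
    and high: "\<And>t k i. t \<in> {1..T} \<Longrightarrow> k \<in> {1..K} \<Longrightarrow> i \<in> {1..T} \<Longrightarrow> t < i \<Longrightarrow>
      dotp (v i) (query a (orc (fam (t - 1) v)) t k) < G * \<mu> / 4"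
  shows "ereal (A * G * real T) \<le> gap T K X (query a (orc (fam T v))) (fam T v)"
proof -
  have clamp: "clamp v i = v i" if "i \<in> {1..T}" for i
    using dual[OF that] that by (simp add: clamp_def)
  let ?q = "\<lambda>t k. query a (orc (fam (t - 1) v)) t k"
  have q: "?q t k \<in> X" if "1 \<le> k" "k \<le> K" for t k
    by (rule query_in[OF a that])
  have agree: "orc (fam t' v) (?q t k) = orc (fam T v) (?q t k)"
    if t: "1 \<le> t" "t \<le> t'" "t' \<le> T" and k: "1 \<le> k" "k \<le> K" for t t' k
  proof -
    \<comment> \<open>Strict inequalities make this an open neighborhood of the query, on the whole
      of which \<open>hard_trunc_eq\<close> applies.\<close>
    let ?U = "{y. - (G * \<mu> / 4) < dotp (v t) y} \<inter> (\<Inter>i\<in>{t<..T}. {y. dotp (v i) y < G * \<mu> / 4})"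
    have "continuous_on UNIV (dotp u)" for u
      by (rule linear_continuous_on[OF bounded_linear_dotp])
    then have "open ?U"
      by (intro open_Int open_INT ballI open_Collect_less continuous_on_const) auto
    moreover have x: "?q t k \<in> Rd d" using q[OF k] X(1) by blast
    moreover have "?q t k \<in> ?U"
      using low[of t k] high[of t k] t k by simp
    moreover have "fam t' v y = fam T v y" if y: "y \<in> ?U \<inter> Rd d" for y
    proof -
      have "hard (trunc (clamp v) t) y = hard (trunc (clamp v) s) y" if "t \<le> s" "s \<le> T" for s
        by (rule hard_trunc_eq[where T = T]) (use t T y that clamp in auto)
      from this[of t'] this[of T] show ?thesis using t y by (simp add: fam_def)
    qed
    ultimately have "\<exists>U. open U \<and> ?q t k \<in> U \<and> (\<forall>y\<in>U \<inter> Rd d. fam t' v y = fam T v y)"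
      by (intro exI[of _ ?U] conjI ballI)
    with orc[unfolded local_oracle_def, THEN bspec, OF fam_in_family, THEN bspec, OF fam_in_family,
        THEN bspec, OF x, THEN mp]
    show ?thesis .
  qed
  have query: "query a (orc (fam T v)) t k = ?q t k" if "t \<le> T" for t k
    using query_agree[where a = a and K = K and T = T and ans = "\<lambda>t. orc (fam t v)",
        OF a[THEN conjunct1] agree that] .
  let ?S = "{fam T v (query a (orc (fam T v)) t k) | t k. t \<in> {1..T} \<and> k \<in> {1..K}}"
  have S: "?S = (\<lambda>(t, k). fam T v (query a (orc (fam T v)) t k)) ` ({1..T} \<times> {1..K})"
    by (rule setcompr_pairs)
  have "- (A * G * (real T - 3 / 4)) \<le> Min ?S"
  proof (rule Min.boundedI)
    show "finite ?S" unfolding S by simp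
    show "?S \<noteq> {}" unfolding S using T K by simp
    fix u assume "u \<in> ?S"
    then obtain t k where u: "u = fam T v (query a (orc (fam T v)) t k)" and tk: "t \<in> {1..T}" "k \<in> {1..K}"
      by blast
    have "?q t k \<in> Rd d" using q[of k t] X(1) tk by auto
    moreover have "u = fam T v (?q t k)" using query[of t k] tk by (simp add: u)
    ultimately have "u = hard (trunc (clamp v) T) (?q t k)" by (simp add: fam_def)
    then show "- (A * G * (real T - 3 / 4)) \<le> u"
      using hard_ge[of t T "clamp v" "?q t k"] low[OF tk] tk T clamp[OF tk(1)] by simp
  qed
  moreover have "(INF y\<in>X. ereal (fam T v y)) \<le> ereal (- (A * G * (2 * real T - 1 / 4)))"
  proof -
    \<comment> \<open>Attainment of the infimum is not assumed; giving up half of the descent makes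
      the inequality strict and yields an actual point.\<close>
    have "0 < real T * G * \<mu>" using T G_pos \<mu>_pos by simp
    then have "ereal (- (4 * real T * G * \<mu>)) < ereal (- (2 * real T * G * \<mu>))"
      unfolding less_ereal.simps by linarith
    with min have "(INF x\<in>X. ereal (MAX i\<in>{1..T}. dotp (v i) x)) < ereal (- (2 * real T * G * \<mu>))"
      by (rule le_less_trans)
    then obtain x where x: "x \<in> X" and max: "(MAX i\<in>{1..T}. dotp (v i) x) < - (2 * real T * G * \<mu>)"
      unfolding INF_less_iff by auto
    have x_le: "dotp (v i) x \<le> - (2 * real T * G * \<mu>)" if "i \<in> {1..T}" for i
    proof -
      have "dotp (v i) x \<le> (MAX i\<in>{1..T}. dotp (v i) x)"
        using that by (intro Max_ge) simp_all
      with max show ?thesis by linarith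
    qed
    have "hard (trunc (clamp v) T) x \<le> - (A * G * (2 * real T - 1 / 4))"
    proof (intro hard_le T)
      show "dotp (clamp v i) x \<le> - (2 * real T * G * \<mu>)" if "1 \<le> i" "i \<le> T" for i
        using x_le[of i] clamp[of i] that by simp
    qed
    then have "ereal (fam T v x) \<le> ereal (- (A * G * (2 * real T - 1 / 4)))"
      using x X(1) by (simp add: fam_def subset_iff)
    then show ?thesis using x by (rule INF_lower2[rotated])
  qed
  ultimately have "ereal (- (A * G * (real T - 3 / 4))) - ereal (- (A * G * (2 * real T - 1 / 4)))
      \<le> gap T K X (query a (orc (fam T v))) (fam T v)"
    unfolding gap_def by (intro ereal_minus_mono) auto
  \<comment> \<open>The difference is \<open>A * G * (T + 1 / 2)\<close>.\<close>
  moreover have "A * G * real T \<le> - (A * G * (real T - 3 / 4)) - - (A * G * (2 * real T - 1 / 4))"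
    using A_pos G_pos by (simp add: algebra_simps)
  then have "ereal (A * G * real T) \<le>
      ereal (- (A * G * (real T - 3 / 4))) - ereal (- (A * G * (2 * real T - 1 / 4)))"
    by simp
  ultimately show ?thesis by (rule order_trans[rotated])
qed

section \<open>Failure events and success probability for a fixed algorithm and oracle\<close>

context
  fixes orc :: "(vec \<Rightarrow> real) \<Rightarrow> vec \<Rightarrow> 'v::real_vector" and S :: "'s measure"
    and alg :: "'s \<Rightarrow> 'v history \<Rightarrow> vec list"
  assumes orc: "local_oracle (Rd d) family orc"
    and alg: "parallel_algorithm K X S alg"
    and queries: "random_queries T K S alg \<Delta> orc"
begin

lemma S: "prob_space S"
  and alg_in: "s \<in> space S \<Longrightarrow> length (alg s h) = K \<and> set (alg s h) \<subseteq> X"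
  using alg by (auto simp: parallel_algorithm_def)

lemma measurable_query:
  "t \<in> {1..T} \<Longrightarrow> k \<in> {1..K} \<Longrightarrow>
    (\<lambda>(s, f). query (alg s) (orc f) t k) \<in> borel_measurable (S \<Otimes>\<^sub>M family_algebra)"
  using queries sets_\<Delta>
  by (auto simp: random_queries_def cong: measurable_cong_sets sets_pair_measure_cong)

lemma measurable_gap:
  "(\<lambda>(s, f). gap T K X (query (alg s) (orc f)) f) \<in> borel_measurable (S \<Otimes>\<^sub>M family_algebra)"
proof -
  let ?M = "S \<Otimes>\<^sub>M family_algebra"
  have ev: "(\<lambda>m. snd m x) \<in> borel_measurable ?M" if "x \<in> Rd d" for x
    using measurable_compose[OF measurable_snd measurable_eval[OF that]] .
  have snd: "snd m \<in> family" if "m \<in> space ?M" for m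
    using that by (auto simp: space_pair_measure space_family_algebra)
  have val: "(\<lambda>m. snd m (query (alg (fst m)) (orc (snd m)) t k)) \<in> borel_measurable ?M"
    if "t \<in> {1..T}" "k \<in> {1..K}" for t k
  proof (rule measurable_eval_Rd[where F = "\<lambda>m. snd m"])
    show "(\<lambda>m. query (alg (fst m)) (orc (snd m)) t k) \<in> borel_measurable ?M"
      using measurable_query[OF that] by (simp add: case_prod_unfold)
    show "query (alg (fst m)) (orc (snd m)) t k \<in> Rd d" if "m \<in> space ?M" for m
    proof -
      have "fst m \<in> space S" using that by (auto simp: space_pair_measure)
      from query_in[where a = "alg (fst m)", OF alg_in[OF this]] X(1) \<open>k \<in> {1..K}\<close> show ?thesis by auto
    qed
  qed (use ev snd continuous_on_family in auto)
  have S: "{f (x t k) | t k. t \<in> {1..T} \<and> k \<in> {1..K}} = (\<lambda>(t, k). f (x t k)) ` ({1..T} \<times> {1..K})"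
    for f :: "vec \<Rightarrow> real" and x
    by (rule setcompr_pairs)
  have "(\<lambda>m. Min ((\<lambda>i. snd m (query (alg (fst m)) (orc (snd m)) (fst i) (snd i))) ` ({1..T} \<times> {1..K})))
      \<in> borel_measurable ?M"
    using val by (intro borel_measurable_Min) auto
  moreover have "(\<lambda>m. INF y\<in>X. ereal (snd m y)) \<in> borel_measurable ?M"
  proof (rule measurable_INF_Rd[OF X(1)])
    show "(\<lambda>m. snd m y) \<in> borel_measurable ?M" if "y \<in> X" for y
      using ev X(1) that by blast
    show "continuous_on X (snd m)" if "m \<in> space ?M" for m
      using continuous_on_family[OF snd[OF that]] X(1) by (rule continuous_on_subset)
  qed
  ultimately show ?thesis
    unfolding gap_def case_prod_unfold S by measurable
qed

text \<open>The current vector \<open>i = t\<close> must not be too negative at the query, the later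
  ones \<open>i > t\<close> not too positive; hence the sign. Earlier vectors are already known and
  give the empty event, which lets the union run over a full box.\<close>

definition bad :: "nat \<Rightarrow> nat \<Rightarrow> nat \<Rightarrow> ('s \<times> 'w) set" where
  "bad t k i = (if t \<le> i then {(s, \<omega>) \<in> space (S \<Otimes>\<^sub>M M). G * \<mu> / 4 \<le> (if i = t then - 1 else 1) *
      dotp (z i \<omega>) (query (alg s) (orc (fam (t - 1) (\<lambda>j\<in>{1..<t}. z j \<omega>))) t k)} else {})"

text \<open>Measurability of the queries refers only to the sigma-algebra of the family and not to
  the law \<Delta>, so it may be applied along the truncated functions. Their queries thereby become
  measurable in the seed and the vectors before \<open>t\<close>, as \<open>prefix_deviation\<close>
  requires.\<close>

lemma bad:
  assumes "t \<in> {1..T}" "k \<in> {1..K}" "i \<in> {1..T}"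
  shows "bad t k i \<in> sets (S \<Otimes>\<^sub>M M)" "measure (S \<Otimes>\<^sub>M M) (bad t k i) \<le> p"
proof -
  let ?P = "\<Pi>\<^sub>M j\<in>{1..<t}. (borel :: vec measure)"
  let ?g = "\<lambda>(s, y). query (alg s) (orc (fam (t - 1) y)) t k"
  have "(\<lambda>y. fam (t - 1) y) \<in> measurable ?P family_algebra"
    by (intro measurable_fam measurable_component_singleton) auto
  then have "(\<lambda>m. (fst m, fam (t - 1) (snd m))) \<in> measurable (S \<Otimes>\<^sub>M ?P) (S \<Otimes>\<^sub>M family_algebra)"
    by measurable
  from measurable_compose[OF this measurable_query[OF assms(1,2)]]
  have g: "?g \<in> borel_measurable (S \<Otimes>\<^sub>M ?P)"
    by (simp add: case_prod_unfold)
  have gX: "?g (s, y) \<in> X" if "s \<in> space S" for s y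
    using query_in[where a = "alg s", OF alg_in[OF that]] assms by simp
  have p0: "0 \<le> p"
  proof -
    obtain x where "x \<in> X" using X(2) by blast
    from order_trans[OF measure_nonneg tail[of 1 x 1]] this T show ?thesis by simp
  qed
  have "bad t k i \<in> sets (S \<Otimes>\<^sub>M M) \<and> measure (S \<Otimes>\<^sub>M M) (bad t k i) \<le> p"
  proof (cases "t \<le> i")
    case True
    have "1 \<le> t" "i \<le> T" using assms by auto
    have c: "(if i = t then - 1 else 1) \<in> {- 1, 1 :: real}" by simp
    note dev = prefix_deviation[OF prob_space_axioms S indep \<open>1 \<le> t\<close> True \<open>i \<le> T\<close> g gX
        z_Rd[OF assms(3)] tail[OF assms(3) _ c], unfolded prod.case]
    show ?thesis
      unfolding bad_def if_P[OF True] by (intro conjI dev)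
  qed (simp add: bad_def p0)
  then show "bad t k i \<in> sets (S \<Otimes>\<^sub>M M)" "measure (S \<Otimes>\<^sub>M M) (bad t k i) \<le> p" by auto
qed

text \<open>One \<eta> pays for failure of the common descent, the other for the union of the bad
  events.\<close>

lemma gap_probability:
  assumes c: "c \<le> A * G * real T"
  shows "1 - 2 * \<eta> \<le> measure (S \<Otimes>\<^sub>M \<Delta>) {(s, f) \<in> space (S \<Otimes>\<^sub>M \<Delta>).
      ereal c \<le> gap T K X (query (alg s) (orc f)) f}"
proof -
  interpret S: prob_space S by (rule S)
  interpret \<Delta>: prob_space \<Delta> by (rule prob_space_\<Delta>)
  interpret SM: pair_prob_space S M ..
  let ?E = "{(s, f) \<in> space (S \<Otimes>\<^sub>M \<Delta>). ereal c \<le> gap T K X (query (alg s) (orc f)) f}"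
  let ?h = "\<lambda>(s, \<omega>). (s, F \<omega>)"
  let ?W = "{\<omega> \<in> space M. (INF x\<in>X. ereal (MAX i\<in>{1..T}. dotp (z i \<omega>) x)) \<le> ereal (- (4 * real T * G * \<mu>))}"
  have space: "space (S \<Otimes>\<^sub>M \<Delta>) = space (S \<Otimes>\<^sub>M family_algebra)"
    by (simp add: space_pair_measure space_\<Delta> space_family_algebra)
  have "{m \<in> space (S \<Otimes>\<^sub>M family_algebra). ereal c \<le> (\<lambda>(s, f). gap T K X (query (alg s) (orc f)) f) m}
      \<in> sets (S \<Otimes>\<^sub>M family_algebra)"
    using measurable_gap by measurable
  also have "{m \<in> space (S \<Otimes>\<^sub>M family_algebra). ereal c \<le> (\<lambda>(s, f). gap T K X (query (alg s) (orc f)) f) m} = ?E"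
    unfolding space by auto
  finally have E: "?E \<in> sets (S \<Otimes>\<^sub>M family_algebra)" .
  have h: "?h \<in> measurable (S \<Otimes>\<^sub>M M) (S \<Otimes>\<^sub>M family_algebra)"
    using measurable_F by measurable
  \<comment> \<open>Presenting the seed as its own image under the identity makes the product with
    \<Delta> the image of \<open>S \<Otimes>\<^sub>M M\<close>, where the independence argument
    takes place.\<close>
  have "distr S S (\<lambda>s. s) \<Otimes>\<^sub>M \<Delta> = distr (S \<Otimes>\<^sub>M M) (S \<Otimes>\<^sub>M family_algebra) ?h"
    unfolding \<Delta>_def using \<Delta>.sigma_finite_measure_axioms
    by (intro pair_measure_distr measurable_ident_sets measurable_F) (simp_all add: \<Delta>_def)
  then have "measure (S \<Otimes>\<^sub>M \<Delta>) ?E = measure (S \<Otimes>\<^sub>M M) (?h -` ?E \<inter> space (S \<Otimes>\<^sub>M M))"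
    using measure_distr[OF h E] by (simp add: distr_id)
  moreover have "1 - 2 * \<eta> \<le> measure (S \<Otimes>\<^sub>M M) (?h -` ?E \<inter> space (S \<Otimes>\<^sub>M M))"
  proof -
    \<comment> \<open>Nonmeasurable sets have measure 0 by convention, so positive measure proves
      that the descent event is measurable.\<close>
    have "0 < measure M ?W" using descent \<eta> by linarith
    then have W: "?W \<in> sets M" using measure_notin_sets by force
    have "AE \<omega> in M. \<forall>i\<in>{1..T}. dual_norm (Rd d) N (z i \<omega>) \<le> 1"
      using z_dual by (intro eventually_ball_finite) auto
    then obtain Z where Z: "{\<omega> \<in> space M. \<not> (\<forall>i\<in>{1..T}. dual_norm (Rd d) N (z i \<omega>) \<le> 1)} \<subseteq> Z"
      "emeasure M Z = 0" "Z \<in> sets M"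
      by (rule AE_E)
    have "measure M (?W - Z) = measure M ?W"
      using Z W by (intro measure_Diff_null_set) auto
    then have WZ: "1 - \<eta> \<le> measure M (?W - Z)" using descent by simp
    let ?G = "space S \<times> (?W - Z)"
    have G: "?G \<in> sets (S \<Otimes>\<^sub>M M)" using W Z(3) by auto
    have "emeasure (S \<Otimes>\<^sub>M M) ?G = emeasure M (?W - Z)"
      using W Z(3) by (subst emeasure_pair_measure_Times) (auto simp: S.emeasure_space_1)
    then have PG: "1 - \<eta> \<le> measure (S \<Otimes>\<^sub>M M) ?G" using WZ by (simp add: measure_def)
    let ?I = "{1..T} \<times> {1..K} \<times> {1..T}"
    let ?bad = "\<Union>(t, k, i)\<in>?I. bad t k i"
    have bad_sets: "?bad \<in> sets (S \<Otimes>\<^sub>M M)"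
      using bad(1) by (intro sets.finite_UN) auto
    have "measure (S \<Otimes>\<^sub>M M) ?bad \<le> (\<Sum>j\<in>?I. measure (S \<Otimes>\<^sub>M M) (case j of (t, k, i) \<Rightarrow> bad t k i))"
      using bad(1) by (intro SM.finite_measure_subadditive_finite) auto
    also have "\<dots> \<le> (\<Sum>j\<in>?I. p)"
      using bad(2) by (intro sum_mono) auto
    also have "\<dots> \<le> \<eta>"
      using p by (simp add: algebra_simps)
    finally have Pbad: "measure (S \<Otimes>\<^sub>M M) ?bad \<le> \<eta>" .
    have "?G - ?bad \<subseteq> ?h -` ?E \<inter> space (S \<Otimes>\<^sub>M M)"
    proof
      fix m assume m: "m \<in> ?G - ?bad"
      obtain s \<omega> where m_eq: "m = (s, \<omega>)" by (cases m)
      have s: "s \<in> space S" and \<omega>: "\<omega> \<in> space M" "\<omega> \<in> ?W" "\<omega> \<notin> Z" using m by (auto simp: m_eq)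
      have nbad: "m \<notin> bad t k i" if "t \<in> {1..T}" "k \<in> {1..K}" "i \<in> {1..T}" for t k i
        using m that by blast
      have sm: "(s, \<omega>) \<in> space (S \<Otimes>\<^sub>M M)" using s \<omega>(1) by (simp add: space_pair_measure)
      let ?v = "\<lambda>i. z i \<omega>"
      have fam: "fam (t - 1) (\<lambda>j\<in>{1..<t}. z j \<omega>) = fam (t - 1) ?v" for t
        by (rule fam_cong) auto
      have "ereal (A * G * real T) \<le> gap T K X (query (alg s) (orc (fam T ?v))) (fam T ?v)"
      proof (rule gap_good[OF orc alg_in[OF s]])
        have "\<forall>i\<in>{1..T}. dual_norm (Rd d) N (z i \<omega>) \<le> 1"
          using Z(1) \<omega>(1,3) by blast
        then show "?v i \<in> dual_ball" if "i \<in> {1..T}" for i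
          using \<omega>(1) that z_Rd by (intro dual_ballI) blast+
        show "(INF x\<in>X. ereal (MAX i\<in>{1..T}. dotp (?v i) x)) \<le> ereal (- (4 * real T * G * \<mu>))"
          using \<omega>(2) by simp
        show "- (G * \<mu> / 4) < dotp (?v t) (query (alg s) (orc (fam (t - 1) ?v)) t k)"
          if "t \<in> {1..T}" "k \<in> {1..K}" for t k
          using nbad[OF that that(1)] sm by (simp add: bad_def m_eq fam[simplified])
        show "dotp (?v i) (query (alg s) (orc (fam (t - 1) ?v)) t k) < G * \<mu> / 4"
          if "t \<in> {1..T}" "k \<in> {1..K}" "i \<in> {1..T}" "t < i" for t k i
          using nbad[OF that(1-3)] sm that(4) by (simp add: bad_def m_eq fam[simplified])
      qed
      moreover have "ereal c \<le> ereal (A * G * real T)" using c by simp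
      ultimately have "ereal c \<le> gap T K X (query (alg s) (orc (F \<omega>))) (F \<omega>)"
        unfolding F_def by (rule order_trans[rotated])
      moreover have "F \<omega> \<in> space \<Delta>" by (simp add: F_def space_\<Delta> fam_in_family)
      ultimately show "m \<in> ?h -` ?E \<inter> space (S \<Otimes>\<^sub>M M)"
        using s sm by (simp add: m_eq space_pair_measure)
    qed
    then have "measure (S \<Otimes>\<^sub>M M) (?G - ?bad) \<le> measure (S \<Otimes>\<^sub>M M) (?h -` ?E \<inter> space (S \<Otimes>\<^sub>M M))"
      using measurable_sets[OF h E] by (intro SM.finite_measure_mono)
    moreover have "measure (S \<Otimes>\<^sub>M M) ?G \<le> measure (S \<Otimes>\<^sub>M M) ((?G - ?bad) \<union> ?bad)"
      using G bad_sets by (intro SM.finite_measure_mono) auto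
    moreover have "\<dots> \<le> measure (S \<Otimes>\<^sub>M M) (?G - ?bad) + measure (S \<Otimes>\<^sub>M M) ?bad"
      using G bad_sets by (intro measure_Un_le) auto
    ultimately show ?thesis using PG Pbad by linarith
  qed
  ultimately show ?thesis by simp
qed

end

end


section \<open>The lower bound\<close>

lemma depth_exists:
  assumes "1 \<le> T"
  shows "\<exists>l. T \<le> 2 ^ l \<and> real l \<le> 2 * (1 + ln (real T))"
proof (intro exI conjI)
  let ?l = "nat \<lceil>log 2 (real T)\<rceil>"
  have log: "0 \<le> log 2 (real T)" using assms by (simp add: zero_le_log_cancel_iff)
  have "real T = 2 powr log 2 (real T)" using assms by simp
  also have "\<dots> \<le> 2 powr real ?l" using log by (intro powr_mono) auto
  also have "\<dots> = real (2 ^ ?l)" by (simp add: powr_realpow)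
  finally show "T \<le> 2 ^ ?l" by (simp only: of_nat_le_iff)
  have "ln (real T) * (1 / 2) \<le> ln (real T) * ln 2"
    using ln2_ge_two_thirds assms by (intro mult_left_mono) auto
  then have "ln (real T) / ln 2 \<le> 2 * ln (real T)"
    using ln2_ge_two_thirds by (simp add: field_simps)
  then have "log 2 (real T) \<le> 2 * ln (real T)" by (simp add: log_def)
  moreover have "real ?l \<le> log 2 (real T) + 1"
    using log of_int_ceiling_le_add_one[of "log 2 (real T)"] by simp
  ultimately show "real ?l \<le> 2 * (1 + ln (real T))" by simp
qed

text \<open>With \<open>e = q + \<nu>\<close> the right-hand side equals
  \<open>Y * G / ((4 * G) powr e * (2 * B))\<close>. Since \<open>Suc l \<le> 3 * lg\<close>, one
  has \<open>4 * G \<le> 48 * Suc q * lg\<close> and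
  \<open>2 * B \<le> 2 * C * 3 ^ p\<^sub>0 * lg ^ p\<^sub>0\<close>; with
  \<open>e \<le> q + 1\<close> these give the numerical constant and the exponent of the logarithm.
  The power of \<open>R\<close> is absorbed by \<open>max 1 R\<^sub>0\<close>.\<close>

lemma rate_bound:
  fixes \<Theta> L \<nu> R R\<^sub>0 C :: real and q p\<^sub>0 l T :: nat
  assumes pos: "0 < \<Theta>" "0 < L" "0 < \<nu>" "\<nu> \<le> 1" "0 < R" "R \<le> R\<^sub>0" "1 \<le> C" "1 \<le> T"
    and l: "real l \<le> 2 * (1 + ln (real T))"
  defines "G \<equiv> 4 * real (Suc q) * real (Suc l)"
  defines "\<mu> \<equiv> \<Theta> / (4 * real T * G)"
  defines "B \<equiv> C * (1 + real l) ^ p\<^sub>0"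
  shows "1 / ((48 * real (Suc q)) ^ Suc q * (2 * C * 3 ^ p\<^sub>0) * (max 1 R\<^sub>0) ^ Suc q) *
      (L * R powr (real q + \<nu>) * \<Theta> powr (real q + \<nu>) / real T powr (real q + \<nu> - 1))
        / (1 + ln (real T)) ^ (Suc q + p\<^sub>0)
    \<le> L * \<mu> powr (real q + \<nu>) / (2 * B) * G * real T"
proof -
  define lg where "lg = 1 + ln (real T)"
  define e where "e = real q + \<nu>"
  define Y where "Y = L * \<Theta> powr e / real T powr (e - 1)"
  let ?m = "(max 1 R\<^sub>0) ^ Suc q" and ?a = "(48 * real (Suc q)) ^ Suc q" and ?b = "2 * C * 3 ^ p\<^sub>0"
  have lg: "1 \<le> lg" using pos by (simp add: lg_def)
  have l': "real (Suc l) \<le> 3 * lg" using l lg by (simp add: lg_def)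
  have G: "1 \<le> G"
  proof -
    have "1 * 1 \<le> (4 * real (Suc q)) * real (Suc l)" by (intro mult_mono) auto
    then show ?thesis by (simp add: G_def)
  qed
  have B: "1 \<le> B"
  proof -
    have "1 * 1 \<le> C * (1 + real l) ^ p\<^sub>0" using pos by (intro mult_mono one_le_power) auto
    then show ?thesis by (simp add: B_def)
  qed
  have Y: "0 \<le> Y" using pos by (simp add: Y_def)
  have R: "R powr e \<le> ?m"
  proof -
    have "R powr e \<le> max 1 R\<^sub>0 powr e" using pos by (intro powr_mono2) (auto simp: e_def)
    also have "\<dots> \<le> max 1 R\<^sub>0 powr real (Suc q)" using pos by (intro powr_mono) (auto simp: e_def)
    also have "\<dots> = ?m" by (rule powr_realpow) simp
    finally show ?thesis .
  qed
  have G_le: "4 * G \<le> 48 * real (Suc q) * lg"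
  proof -
    have "4 * G = (16 * real (Suc q)) * real (Suc l)" by (simp add: G_def)
    also have "\<dots> \<le> (16 * real (Suc q)) * (3 * lg)" using l' by (intro mult_left_mono) auto
    also have "\<dots> = 48 * real (Suc q) * lg" by simp
    finally show ?thesis .
  qed
  have "(4 * G) powr e \<le> (4 * G) powr real (Suc q)" using G pos by (intro powr_mono) (auto simp: e_def)
  also have "\<dots> = (4 * G) ^ Suc q" using G by (intro powr_realpow) simp
  also have "\<dots> \<le> (48 * real (Suc q) * lg) ^ Suc q" using G G_le by (intro power_mono) auto
  finally have 1: "(4 * G) powr e \<le> ?a * lg ^ Suc q" by (simp only: power_mult_distrib)
  have "(1 + real l) ^ p\<^sub>0 \<le> (3 * lg) ^ p\<^sub>0" using l' by (intro power_mono) auto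
  then have 2: "2 * B \<le> ?b * lg ^ p\<^sub>0"
    using pos by (simp add: B_def power_mult_distrib)
  have "(4 * G) powr e * (2 * B) \<le> (?a * lg ^ Suc q) * (?b * lg ^ p\<^sub>0)"
    by (rule mult_mono[OF 1 2]) (use B lg in auto)
  also have "\<dots> = ?a * ?b * lg ^ (Suc q + p\<^sub>0)" by (simp only: power_add ac_simps)
  finally have le: "(4 * G) powr e * (2 * B) \<le> ?a * ?b * lg ^ (Suc q + p\<^sub>0)" .
  have "1 / (?a * ?b * ?m) * (L * R powr e * \<Theta> powr e / real T powr (e - 1)) / lg ^ (Suc q + p\<^sub>0)
      = Y * (R powr e / ?m) / (?a * ?b * lg ^ (Suc q + p\<^sub>0))"
    by (simp add: Y_def ac_simps)
  also have "\<dots> \<le> Y * 1 / (?a * ?b * lg ^ (Suc q + p\<^sub>0))"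
    using Y R pos lg by (intro divide_right_mono mult_left_mono) (auto simp: divide_le_eq_1)
  also have "\<dots> \<le> Y * G / ((4 * G) powr e * (2 * B))"
    using Y G B le by (intro frac_le mult_left_mono) auto
  also have "\<dots> = L * \<mu> powr e / (2 * B) * G * real T"
  proof -
    have "\<mu> powr e = \<Theta> powr e / (real T powr e * (4 * G) powr e)"
      using pos G unfolding \<mu>_def by (simp add: powr_divide powr_mult mult.assoc mult.left_commute)
    moreover have "real T powr e = real T powr (e - 1) * real T"
      using pos powr_add[of "real T" "e - 1" 1] by simp
    ultimately show ?thesis
      using pos G B by (simp add: Y_def field_simps)
  qed
  finally show ?thesis by (simp only: lg_def e_def)
qed

text \<open>Write \<open>r = T * K / \<eta>\<close>. Dividing 64 by 16 leaves
  \<open>4 * sqrt (ln r / Mt)\<close>, so the exponent is at least \<open>16 * ln r\<close>. It is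
  weakened to \<open>2 * ln r\<close>, and \<open>T * T * K / r\<^sup>2\<close> is
  \<open>\<eta> * \<eta> / K\<close>.\<close>

lemma union_bound:
  fixes \<Theta> Mt \<eta> :: real
  assumes T: "1 \<le> T" and K: "1 \<le> K" and Mt: "0 < Mt" and \<eta>: "0 < \<eta>" "\<eta> < 1"
    and \<Theta>: "64 * real T * sqrt (ln (real T * real K / \<eta>) / Mt) \<le> \<Theta>"
  shows "real T * real T * real K * exp (- Mt * (\<Theta> / (16 * real T))\<^sup>2) \<le> \<eta>"
proof -
  let ?r = "real T * real K / \<eta>"
  have "1 * 1 \<le> real T * real K" using T K by (intro mult_mono) auto
  then have r: "1 \<le> ?r" using \<eta> by (simp add: field_simps)
  then have ln: "0 \<le> ln ?r" by simp
  have "4 * sqrt (ln ?r / Mt) \<le> \<Theta> / (16 * real T)" using \<Theta> T by (simp add: field_simps)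
  then have "(4 * sqrt (ln ?r / Mt))\<^sup>2 \<le> (\<Theta> / (16 * real T))\<^sup>2"
    using ln Mt by (intro power_mono) auto
  then have "16 * (ln ?r / Mt) \<le> (\<Theta> / (16 * real T))\<^sup>2"
    using ln Mt by (simp add: power_mult_distrib)
  then have "16 * ln ?r \<le> Mt * (\<Theta> / (16 * real T))\<^sup>2"
    using Mt by (simp add: field_simps)
  then have "exp (- Mt * (\<Theta> / (16 * real T))\<^sup>2) \<le> exp (- (2 * ln ?r))"
    using ln by simp
  also have "\<dots> = inverse (?r\<^sup>2)"
  proof -
    have "exp (2 * ln ?r) = (exp (ln ?r))\<^sup>2" by (simp only: power2_eq_square exp_add[symmetric]) simp
    then show ?thesis using r by (simp only: exp_minus exp_ln)
  qed
  finally have "real T * real T * real K * exp (- Mt * (\<Theta> / (16 * real T))\<^sup>2) \<le>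
      real T * real T * real K * inverse (?r\<^sup>2)"
    by (intro mult_left_mono) auto
  also have "\<dots> = \<eta> * (\<eta> / real K)"
    using T K \<eta> by (simp add: power2_eq_square field_simps)
  also have "\<dots> \<le> \<eta> * 1"
    using K \<eta> by (intro mult_left_mono) (auto simp: field_simps)
  finally show ?thesis by simp
qed

theorem theorem26:
  fixes q :: nat
  assumes "q \<ge> 1"
  shows "\<exists>p::nat. \<forall>R0>0::real. \<exists>c>0::real.
    \<forall>(d::nat) (N :: vec \<Rightarrow> real) (X :: vec set) (R::real) (T::nat) (K::nat)
      (\<Theta>::real) (Mt::real) (\<eta>::real) (M :: 'w measure) (z :: nat \<Rightarrow> 'w \<Rightarrow> vec).
      norm_on (Rd d) N \<and>
      X \<subseteq> Rd d \<and> closed X \<and> convex X \<and>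
      0 < R \<and> R \<le> R0 \<and> {x \<in> Rd d. N x \<le> R} \<subseteq> X \<and>
      T \<ge> 1 \<and> K \<ge> 1 \<and> \<Theta> > 0 \<and> Mt > 0 \<and> 0 < \<eta> \<and> \<eta> < 1/2 \<and>
      prob_space M \<and>
      prob_space.indep_vars M (\<lambda>_. borel) z {1..T} \<and>
      (\<forall>i\<in>{1..T}. \<forall>\<omega>\<in>space M. z i \<omega> \<in> Rd d) \<and>
      (\<forall>i\<in>{1..T}. AE \<omega> in M. dual_norm (Rd d) N (z i \<omega>) \<le> 1) \<and>
      measure M {\<omega> \<in> space M.
          (INF x\<in>X. ereal (MAX i\<in>{1..T}. dotp (z i \<omega>) x)) \<le> ereal (- \<Theta>)} \<ge> 1 - \<eta> \<and>
      (\<forall>i\<in>{1..T}. \<forall>x\<in>X. \<forall>\<delta>>0.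
          max (measure M {\<omega> \<in> space M. dotp (z i \<omega>) x \<ge> \<delta>})
              (measure M {\<omega> \<in> space M. dotp (z i \<omega>) x \<le> - \<delta>}) \<le> exp (- Mt * \<delta>\<^sup>2)) \<and>
      \<Theta> \<ge> 64 * real T * sqrt (ln (real T * real K / \<eta>) / Mt)
      \<longrightarrow>
      (\<forall>L>0. \<forall>\<nu>::real. 0 < \<nu> \<and> \<nu> \<le> 1 \<longrightarrow>
        (\<exists>\<F> \<Delta>.
          (\<forall>F\<in>\<F>. convex_on (Rd d) F \<and> holder_derivative (Rd d) N q L \<nu> F) \<and>
          distribution_on (Rd d) \<F> \<Delta> \<and>
          (\<forall>(orc :: (vec \<Rightarrow> real) \<Rightarrow> vec \<Rightarrow> 'v::real_vector) (S :: 's measure) alg.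
            local_oracle (Rd d) \<F> orc \<and>
            parallel_algorithm K X S alg \<and>
            random_queries T K S alg \<Delta> orc \<longrightarrow>
            measure (S \<Otimes>\<^sub>M \<Delta>) {(s, F) \<in> space (S \<Otimes>\<^sub>M \<Delta>).
                gap T K X (query (alg s) (orc F)) F \<ge>
                  ereal (c * (L * R powr (real q + \<nu>) * \<Theta> powr (real q + \<nu>) / real T powr (real q + \<nu> - 1))
                         / (1 + ln (real T)) ^ p)}
              \<ge> 1 - 2 * \<eta>)))"
proof -
  obtain D where D: "ramp_jet (Suc q) D" using ramp_jet_exists by blast
  have D1: "0 \<le> D 1 s \<and> D 1 s \<le> 1" for s using D by (simp add: ramp_jet_def)
  have Db: "\<exists>C. \<forall>s. \<bar>D j s\<bar> \<le> C" if "1 \<le> j" "j \<le> Suc q" for j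
    using D that by (simp add: ramp_jet_def)
  let ?bound = "\<lambda>C p. \<forall>(Y::nat \<Rightarrow> vec list \<Rightarrow> vec \<Rightarrow> real) U x.
      (\<forall>i B. B \<noteq> [] \<longrightarrow> set B \<subseteq> U \<longrightarrow> \<bar>Y i B x\<bar> \<le> 1) \<longrightarrow>
      (\<forall>l i vs. vs \<noteq> [] \<longrightarrow> length vs \<le> Suc q \<longrightarrow> set vs \<subseteq> U \<longrightarrow>
         \<bar>smax_jet D l Y i vs x\<bar> \<le> C * (1 + real l) ^ p)"
  \<comment> \<open>These constants are fixed before dimension, norm, \<open>T\<close> and \<nu> are
    introduced; they depend on the ramp alone, hence on \<open>q\<close>.\<close>
  have "\<exists>C p. 1 \<le> C \<and> ?bound C p"
    by (rule smax_jet_bound) (rule D1 Db, assumption?)+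
  then obtain C where "\<exists>p. 1 \<le> C \<and> ?bound C p" by (rule exE)
  then obtain p\<^sub>0 where Cp: "1 \<le> C \<and> ?bound C p\<^sub>0" by (rule exE)
  note C = conjunct1[OF Cp] and bound = conjunct2[OF Cp, rule_format]
  let ?c = "\<lambda>R\<^sub>0. 1 / ((48 * real (Suc q)) ^ Suc q * (2 * C * 3 ^ p\<^sub>0) * (max 1 R\<^sub>0) ^ Suc q)"
  have c_pos: "0 < ?c R\<^sub>0" for R\<^sub>0 using C by simp
  show ?thesis
  proof (rule exI[of _ "Suc q + p\<^sub>0"], intro allI impI, goal_cases)
    case (1 R\<^sub>0)
    show ?case
    proof (rule exI[of _ "?c R\<^sub>0"], rule conjI[OF c_pos], intro allI impI, elim conjE)
      fix d T K :: nat and N X and R \<Theta> Mt \<eta> L \<nu> :: real and M :: "'w measure" and z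
      assume norm: "norm_on (Rd d) N" and X: "X \<subseteq> Rd d" and R: "0 < R" "R \<le> R\<^sub>0"
        and ball: "{x \<in> Rd d. N x \<le> R} \<subseteq> X"
        and T: "T \<ge> 1" and K: "K \<ge> 1" and \<Theta>: "\<Theta> > 0" and Mt: "Mt > 0" and \<eta>: "0 < \<eta>" "\<eta> < 1/2"
        and M: "prob_space M" and indep: "prob_space.indep_vars M (\<lambda>_. borel) z {1..T}"
        and z_Rd: "\<forall>i\<in>{1..T}. \<forall>\<omega>\<in>space M. z i \<omega> \<in> Rd d"
        and z_dual: "\<forall>i\<in>{1..T}. AE \<omega> in M. dual_norm (Rd d) N (z i \<omega>) \<le> 1"
        and descent: "measure M {\<omega> \<in> space M.
          (INF x\<in>X. ereal (MAX i\<in>{1..T}. dotp (z i \<omega>) x)) \<le> ereal (- \<Theta>)} \<ge> 1 - \<eta>"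
        and tail: "\<forall>i\<in>{1..T}. \<forall>x\<in>X. \<forall>\<delta>>0.
          max (measure M {\<omega> \<in> space M. dotp (z i \<omega>) x \<ge> \<delta>})
              (measure M {\<omega> \<in> space M. dotp (z i \<omega>) x \<le> - \<delta>}) \<le> exp (- Mt * \<delta>\<^sup>2)"
        and large: "\<Theta> \<ge> 64 * real T * sqrt (ln (real T * real K / \<eta>) / Mt)"
        and L: "L > 0" and \<nu>: "0 < \<nu>" "\<nu> \<le> 1"
      obtain l where l: "T \<le> 2 ^ l" "real l \<le> 2 * (1 + ln (real T))"
        using depth_exists[OF T] by blast
      \<comment> \<open>\<open>Suc l\<close> instead of \<open>l\<close> keeps the requirement on
        \<open>G\<close> strict when the tree has depth 0. The choices of \<mu> and \<open>A\<close>
        solve \<open>4 * T * G * \<mu> = \<Theta>\<close> and the Hoelder equation.\<close>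
      define G where "G = 4 * real (Suc q) * real (Suc l)"
      define \<mu> where "\<mu> = \<Theta> / (4 * real T * G)"
      define B where "B = C * (1 + real l) ^ p\<^sub>0"
      define A where "A = L * \<mu> powr (real q + \<nu>) / (2 * B)"
      have G: "0 < G" by (simp add: G_def)
      have \<mu>: "0 < \<mu>" using T G \<Theta> by (simp add: \<mu>_def)
      have B: "0 < B" using C by (simp add: B_def add_pos_nonneg)
      have A: "0 < A" using L \<mu> B by (simp add: A_def)
      have \<Theta>_eq: "4 * real T * G * \<mu> = \<Theta>" and \<delta>_eq: "G * \<mu> / 4 = \<Theta> / (16 * real T)"
        using T G by (simp_all add: \<mu>_def)
      have "0 < \<Theta> / (16 * real T)" using T \<Theta> by simp
      let ?rate = "?c R\<^sub>0 * (L * R powr (real q + \<nu>) * \<Theta> powr (real q + \<nu>) / real T powr (real q + \<nu> - 1))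
          / (1 + ln (real T)) ^ (Suc q + p\<^sub>0)"
      have rate: "?rate \<le> A * G * real T"
        unfolding A_def B_def \<mu>_def G_def using \<Theta> L \<nu> R C T l(2) by (rule rate_bound)
      interpret prob_space M by (rule M)
      have dist: "hard_distribution d N q D A \<mu> G l M X T K z \<eta> (exp (- Mt * (\<Theta> / (16 * real T))\<^sup>2))"
      proof (unfold_locales, goal_cases)
        case 1 show ?case by (rule norm)
      next
        case 2 show ?case by (rule D)
      next
        case 3 show ?case by (rule A)
      next
        case 4 show ?case by (rule \<mu>)
      next
        case 5 show ?case by (simp add: G_def)
      next
        case 6 show ?case by (rule X)
      next
        case 7
        have "N 0 = 0" using norm by (simp add: norm_on_def)
        then have "0 \<in> {x \<in> Rd d. N x \<le> R}" using R by simp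
        then show ?case using ball by blast
      next
        case 8 show ?case by (rule T)
      next
        case 9 show ?case by (rule l)
      next
        case 10 show ?case by (rule K)
      next
        case 11 show ?case by (rule indep)
      next
        case (12 i \<omega>) then show ?case using z_Rd by blast
      next
        case (13 i) then show ?case using z_dual by blast
      next
        case 14 show ?case unfolding \<Theta>_eq by (rule descent)
      next
        case 15 show ?case using \<eta> by simp
      next
        case (16 i x c)
        with tail \<open>0 < \<Theta> / (16 * real T)\<close> have
          "max (measure M {\<omega> \<in> space M. dotp (z i \<omega>) x \<ge> \<Theta> / (16 * real T)})
              (measure M {\<omega> \<in> space M. dotp (z i \<omega>) x \<le> - (\<Theta> / (16 * real T))})
            \<le> exp (- Mt * (\<Theta> / (16 * real T))\<^sup>2)"
          by blast
        with 16(3) show ?case unfolding \<delta>_eq by (auto simp: le_minus_iff)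
      next
        case 17 show ?case by (rule union_bound) (use T K Mt \<eta> large in auto)
      qed
      interpret hard_distribution d N q D A \<mu> G l M X T K z \<eta> "exp (- Mt * (\<Theta> / (16 * real T))\<^sup>2)"
        by (rule dist)
      have holder: "holder_derivative (Rd d) N q L \<nu> (hard_on \<zeta>)" if \<zeta>: "\<And>i. \<zeta> i \<in> dual_ball" for \<zeta>
      proof (rule holder_hard[OF \<zeta> \<nu> _ _ assms])
        show "\<bar>smax_jet D l (leaf \<zeta>) 0 vs x\<bar> \<le> B"
          if "vs \<noteq> []" "length vs \<le> Suc q" "set vs \<subseteq> {v \<in> Rd d. N v \<le> 1}" for vs x
          unfolding B_def using leaf_le_1[where \<zeta> = \<zeta>, OF \<zeta>] that
          by (rule bound[where Y = "leaf \<zeta>"])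
        show "A * (2 * B) = L * \<mu> powr (real q + \<nu>)" using B by (simp add: A_def)
      qed
      show "\<exists>\<F> \<Delta>.
          (\<forall>F\<in>\<F>. convex_on (Rd d) F \<and> holder_derivative (Rd d) N q L \<nu> F) \<and>
          distribution_on (Rd d) \<F> \<Delta> \<and>
          (\<forall>(orc :: (vec \<Rightarrow> real) \<Rightarrow> vec \<Rightarrow> 'v) (S :: 's measure) alg.
            local_oracle (Rd d) \<F> orc \<and>
            parallel_algorithm K X S alg \<and>
            random_queries T K S alg \<Delta> orc \<longrightarrow>
            measure (S \<Otimes>\<^sub>M \<Delta>) {(s, F) \<in> space (S \<Otimes>\<^sub>M \<Delta>).
                gap T K X (query (alg s) (orc F)) F \<ge> ereal ?rate}
              \<ge> 1 - 2 * \<eta>)"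
      proof (intro exI conjI ballI allI impI)
        show "convex_on (Rd d) f" if "f \<in> family" for f
          using that convex_hard by (auto simp: family_def)
        show "holder_derivative (Rd d) N q L \<nu> f" if "f \<in> family" for f
          using that holder by (auto simp: family_def)
        show "distribution_on (Rd d) family \<Delta>" by (rule distribution_\<Delta>)
        fix orc :: "(vec \<Rightarrow> real) \<Rightarrow> vec \<Rightarrow> 'v" and S :: "'s measure" and alg
        assume "local_oracle (Rd d) family orc \<and> parallel_algorithm K X S alg \<and>
          random_queries T K S alg \<Delta> orc"
        then show "1 - 2 * \<eta> \<le> measure (S \<Otimes>\<^sub>M \<Delta>) {(s, F) \<in> space (S \<Otimes>\<^sub>M \<Delta>).
            ereal ?rate \<le> gap T K X (query (alg s) (orc F)) F}"
          by (intro gap_probability rate) auto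
      qed
    qed
  qed
qed

end
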